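(* Let $\Omega\subseteq S^2$ with $|\partial\Omega|=0$, let $f\in L^1(\bar\Omega)$ with $f>0$ a.e., and let $g_1,\dots,g_N$ be positive numbers with $N>1$. Let $D=\{P_1,\dots,P_N\}\subset\mathbb{R}^3$ be a set of $N$ distinct points with $O\notin D$, and let $M=\max_{1\le i\le N}OP_i$. Define the measure $\eta=\sum_{i=1}^N g_i\,\delta_{P_i}$ on $D$. Fix $\delta>0$, let $c_\delta=-\delta+\sqrt{1+\delta^2}$, let $k\ge \frac{1+c_\delta}{1-c_\delta}$, and suppose that $$\int_{\bar\Omega} f(x)\,dx\ \ge\ \frac{1}{C(\delta,k\delta,M)}\,\eta(D),\qquad\text{where } C(\delta,k\delta,M)=\frac{(1-c_\delta)^3}{(1+c_\delta)(k\delta M)^2}.$$ Then there exists $\bar w=(\bar d_1,\dots,\bar d_N)$ with $\bar d_i\ge\delta M$ for $1\le i\le N$ such that the reflector $\bar\sigma=\{\rho_{\bar w}(x)x\}_{x\in\bar\Omega}$ (which then belongs to $\mathcal A(\delta)$) and its reflector measure $\bar\mu=\mu_{\bar w}$ satisfy: (1) $\bar\Omega=\bigcup_{i=1}^N\tau_{\bar\sigma}(P_i)$; (2) $\bar\mu(P_i)=g_i$ for $2\le i\le N$; (3) $\bar\mu(P_1)>g_1$.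
   Context: $S^2$ is the unit sphere of $\mathbb{R}^3$ centered at the origin $O$; $dx$ and $|\cdot|$ denote surface (Lebesgue) measure on $S^2$; $\bar\Omega$, $\partial\Omega$ are closure and boundary in $S^2$. For $P\ne O$ write $OP=|P|$ and $m_P=P/|P|$. For $d>0$, $E_d(P)$ is the ellipsoid of revolution with foci $O$ and $P$ with polar radius $\rho_d(x)=\frac{d}{1-\varepsilon\,x\cdot m_P}$, $x\in S^2$, where $\varepsilon=\sqrt{1+\frac{d^2}{OP^2}}-\frac{d}{OP}\in(0,1)$ is its eccentricity ($\rho_d$ also depends on $P$). A surface $\sigma=\{\rho(x)x\}_{x\in\bar\Omega}$, $\rho>0$, is a reflector from $\bar\Omega$ to $D$ if for each $x_0\in\bar\Omega$ there is an ellipsoid $E_d(P)$ with $P\in D$ that supports $\sigma$ at $\rho(x_0)x_0$, i.e. $\rho(x)\le\rho_d(x)$ for all $x\in\bar\Omega$ with equality at $x=x_0$. For $P\in D$, $\tau_\sigma(P)$ is the set of $x_0\in\bar\Omega$ such that some $E_d(P)$ (with focus $P$) supports $\sigma$ at $\rho(x_0)x_0$; $\tau_\sigma(E)=\bigcup_{P\in E}\tau_\sigma(P)$. $\mathcal A(\delta)$ is the set of reflectors $\sigma$ from $\bar\Omega$ to $D$ such that for each $x_0\in\bar\Omega$ there is a supporting ellipsoid $E_d(P)$ to $\sigma$ at $\rho(x_0)x_0$ with $P\in D$ and $d\ge\delta M$. For $w=(d_1,\dots,d_N)$ with $d_i>0$, $\rho_w(x)=\min_{1\le i\le N}\rho_{d_i}(x)$,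 where $\rho_{d_i}$ is the polar radius of $E_{d_i}(P_i)$; the associated reflector is $\sigma_w=\{\rho_w(x)x\}_{x\in\bar\Omega}$. Its reflector measure is $$\mu_w(E)=\int_{\tau_{\sigma_w}(E)}f(x)\,\frac{x\cdot\nu_w(x)}{\rho_w(x)^2}\,dx,\qquad E\subseteq D,$$ where $\nu_w(x)$ is the outer unit normal to $\sigma_w$ at $\rho_w(x)x$ (defined for a.e. $x$; a.e. it equals $\frac{x-\varepsilon m_P}{|x-\varepsilon m_P|}$ with $E_d(P)$ the supporting ellipsoid at that point and $\varepsilon$ its eccentricity). $\mu_w(P_i)$ means $\mu_w(\{P_i\})$. *)

theory Defs
  imports "HOL-Analysis.Analysis"
begin

text \<open>
  Surface measure on the unit sphere of \<open>\<real>\<^sup>3\<close>, as the cone measure: the area of a Borel set \<open>A\<close>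
  of the sphere is three times the volume of \<open>{r *\<^sub>R x | 0 < r \<le> 1, x \<in> A}\<close>, the preimage of \<open>A\<close>
  under the radial projection \<^const>\<open>sgn\<close> of the punctured unit ball. It is completed, as
  Lebesgue measure is.
\<close>

definition sphere_measure :: "(real^3) measure" where
  "sphere_measure =
     completion (scale_measure 3
       (distr (restrict_space lborel (cball 0 1 - {0})) (restrict_space borel (sphere 0 1)) sgn))"

lemma space_sphere_measure: "space sphere_measure = sphere 0 1"
  by (simp add: sphere_measure_def space_restrict_space space_scale_measure)

lemma measurable_sgn_sphere:
  "sgn \<in> measurable (restrict_space lborel (cball (0::real^3) 1 - {0})) (restrict_space borel (sphere 0 1))"
proof (rule measurable_restrict_space2)
  show "sgn \<in> space (restrict_space lborel (cball (0::real^3) 1 - {0})) \<rightarrow> sphere 0 1"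
    by (auto simp: space_restrict_space norm_sgn)
  have "sgn \<in> borel_measurable (borel :: (real^3) measure)"
    unfolding sgn_div_norm by measurable
  then show "sgn \<in> measurable (restrict_space lborel (cball (0::real^3) 1 - {0})) borel"
    by (intro measurable_restrict_space1) simp
qed

text \<open>The normalisation is the usual one.\<close>

lemma emeasure_sphere_measure_total: "emeasure sphere_measure (sphere 0 1) = ennreal (4 * pi)"
proof -
  let ?B = "cball (0::real^3) 1 - {0}"
  let ?D = "distr (restrict_space lborel ?B) (restrict_space borel (sphere 0 1)) sgn"
  have S: "sphere (0::real^3) 1 \<in> sets (restrict_space borel (sphere 0 1))"
    by (simp add: sets_restrict_space_iff)
  have "emeasure sphere_measure (sphere 0 1) = 3 * emeasure ?D (sphere 0 1)"
    using S unfolding sphere_measure_def by (subst emeasure_completion) (auto simp: emeasure_scale_measure)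
  also have "emeasure ?D (sphere 0 1) = emeasure (restrict_space lborel ?B) ?B"
    using S by (subst emeasure_distr[OF measurable_sgn_sphere])
      (auto simp: space_restrict_space norm_sgn intro!: arg_cong[where f = "emeasure _"])
  also have "\<dots> = emeasure lborel ?B"
    by (subst emeasure_restrict_space) auto
  also have "\<dots> = emeasure lborel (cball (0::real^3) 1)"
    by (subst emeasure_Diff) auto
  also have "\<dots> = ennreal (4 / 3 * pi)"
    by (simp add: emeasure_cball unit_ball_vol_3)
  also have "3 * \<dots> = ennreal (4 * pi)"
    using ennreal_mult[of 3 "4 / 3 * pi"] by simp
  finally show ?thesis .
qed

abbreviation sphere_top :: "(real^3) topology" where
  "sphere_top \<equiv> top_of_set (sphere 0 1)"

text \<open>
  The ellipsoids \<open>E\<^sub>d(P)\<close> with foci \<open>O = 0\<close> and \<open>P\<close>, where \<open>d > 0\<close> and \<open>P \<noteq> 0\<close>; the unit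
  vector \<open>m\<^sub>P\<close> is \<open>sgn P\<close>.
\<close>

definition ecc :: "real \<Rightarrow> real^3 \<Rightarrow> real" where
  "ecc d P = sqrt (1 + d\<^sup>2 / (norm P)\<^sup>2) - d / norm P"

definition polar_radius :: "real \<Rightarrow> real^3 \<Rightarrow> real^3 \<Rightarrow> real" where
  "polar_radius d P x = d / (1 - ecc d P * (x \<bullet> sgn P))"

text \<open>
  A surface \<open>\<sigma> = {\<rho>(x) x}\<close>, \<open>x \<in> X\<close>, with \<open>X\<close> a subset of the sphere and \<open>\<rho> > 0\<close>, is given by
  its radial function \<open>\<rho>\<close> on \<open>X\<close>, which it determines. None of the notions below depends on the
  values of \<open>\<rho>\<close> outside \<open>X\<close>.
\<close>

definition radial_graph :: "(real^3) set \<Rightarrow> (real^3 \<Rightarrow> real) \<Rightarrow> (real^3) set" where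
  "radial_graph X \<rho> = (\<lambda>x. \<rho> x *\<^sub>R x) ` X"

definition supports_at ::
  "(real^3) set \<Rightarrow> (real^3 \<Rightarrow> real) \<Rightarrow> real \<Rightarrow> real^3 \<Rightarrow> real^3 \<Rightarrow> bool" where
  "supports_at X \<rho> d P x0 \<longleftrightarrow>
     d > 0 \<and> (\<forall>x\<in>X. \<rho> x \<le> polar_radius d P x) \<and> \<rho> x0 = polar_radius d P x0"

definition reflector :: "(real^3) set \<Rightarrow> (real^3) set \<Rightarrow> (real^3 \<Rightarrow> real) \<Rightarrow> bool" where
  "reflector X D \<rho> \<longleftrightarrow>
     (\<forall>x\<in>X. \<rho> x > 0) \<and> (\<forall>x0\<in>X. \<exists>P\<in>D. \<exists>d. supports_at X \<rho> d P x0)"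

definition tau :: "(real^3) set \<Rightarrow> (real^3 \<Rightarrow> real) \<Rightarrow> (real^3) set \<Rightarrow> (real^3) set" where
  "tau X \<rho> E = (\<Union>P\<in>E. {x0 \<in> X. \<exists>d. supports_at X \<rho> d P x0})"

definition refl_class ::
  "(real^3) set \<Rightarrow> (real^3) set \<Rightarrow> real \<Rightarrow> real \<Rightarrow> (real^3 \<Rightarrow> real) set" where
  "refl_class X D M \<delta> =
     {\<rho>. reflector X D \<rho> \<and> (\<forall>x0\<in>X. \<exists>P\<in>D. \<exists>d\<ge>\<delta> * M. supports_at X \<rho> d P x0)}"

text \<open>
  A unit vector is normal to a set \<open>S\<close> at \<open>p\<close> if it is orthogonal to all limits of directions of
  secants of \<open>S\<close> through \<open>p\<close>; it is outer if it points away from the origin. The unit normal is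
  an arbitrary vector at the points where it does not exist or is not unique (for the surfaces
  considered here, a null set of directions: ridges, and the boundary of \<open>X\<close>).
\<close>

definition is_outer_unit_normal :: "(real^3) set \<Rightarrow> real^3 \<Rightarrow> real^3 \<Rightarrow> bool" where
  "is_outer_unit_normal S p n \<longleftrightarrow>
     norm n = 1 \<and> n \<bullet> p > 0 \<and> ((\<lambda>q. n \<bullet> sgn (q - p)) \<longlongrightarrow> 0) (at p within S)"

definition outer_unit_normal :: "(real^3) set \<Rightarrow> real^3 \<Rightarrow> real^3" where
  "outer_unit_normal S p = (THE n. is_outer_unit_normal S p n)"

definition refl_measure ::
  "(real^3) set \<Rightarrow> (real^3 \<Rightarrow> real) \<Rightarrow> (real^3 \<Rightarrow> real) \<Rightarrow> (real^3) set \<Rightarrow> real" where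
  "refl_measure X f \<rho> E =
     (LINT x : tau X \<rho> E | sphere_measure.
        f x * ((x \<bullet> outer_unit_normal (radial_graph X \<rho>) (\<rho> x *\<^sub>R x)) / (\<rho> x)\<^sup>2))"

definition rho_w :: "nat \<Rightarrow> (nat \<Rightarrow> real^3) \<Rightarrow> (nat \<Rightarrow> real) \<Rightarrow> real^3 \<Rightarrow> real" where
  "rho_w N P w x = Min ((\<lambda>i. polar_radius (w i) (P i) x) ` {1..N})"

text \<open>The measure \<open>\<Sum>\<^sub>i g\<^sub>i \<delta>\<^bsub>P\<^sub>i\<^esub>\<close>.\<close>

definition eta :: "nat \<Rightarrow> (nat \<Rightarrow> real) \<Rightarrow> (nat \<Rightarrow> real^3) \<Rightarrow> (real^3) set \<Rightarrow> real" where
  "eta N g P E = (\<Sum>i=1..N. g i * indicator E (P i))"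

definition c_delta :: "real \<Rightarrow> real" where
  "c_delta \<delta> = - \<delta> + sqrt (1 + \<delta>\<^sup>2)"

definition C_const :: "real \<Rightarrow> real \<Rightarrow> real \<Rightarrow> real" where
  "C_const \<delta> \<delta>' M = (1 - c_delta \<delta>) ^ 3 / ((1 + c_delta \<delta>) * (\<delta>' * M)\<^sup>2)"

end

theory Submission
  imports Defs
begin

text \<open>
  Freeze the first weight at \<open>k \<delta> M\<close> and, among the weight vectors for which no other focus receives more
  than its share, take one minimising the sum of the other weights. Lowering \<open>w\<^sub>i\<close> pulls the ellipsoid
  with focus \<open>P\<^sub>i\<close> inwards, which enlarges the set of directions where it is the innermost one and shrinks
  all the others; since the masses depend continuously on the weights, the minimality forces equality for
  every focus but the first. The lower bound \<open>\<delta> M\<close> on the weights is not attained: the ellipsoid would then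
  lie inside the one with focus \<open>P\<^sub>1\<close>, which would receive nothing, although the total mass exceeds
  \<open>C(\<delta>, k\<delta>, M) \<integral> f \<ge> \<eta>(D)\<close>.
\<close>

text \<open>The measure \<open>refl_measure\<close> is not explicit: \<open>tau\<close> admits every
  supporting ellipsoid with a given focus, and the normal is a \<open>THE\<close> over limits of
  secants. Everything runs instead on \<open>cell_mass\<close>, an integral over a closed set with
  an explicit continuous kernel. The two agree because ellipsoids with common focus O and distinct
  second foci meet over at most a circle of directions: equality of two polar radii is a linear
  equation in x. The same fact makes the masses continuous, since off the null set of ties the
  innermost ellipsoid remains innermost under small changes of the weights. The constants come from
  one estimate. For d \<ge> \<delta>M the eccentricity is at most c =
  \<open>c_delta \<delta>\<close>, so the polar radius lies between d/(1+c) and d/(1-c). With the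
  first weight frozen at b = k\<delta>M, every admissible surface stays within radius b/(1-c), and
  the kernel exceeds (1-c)/(1+c) divided by the square of this radius, which is C(\<delta>,
  k\<delta>, M). The bound on k says that \<delta>M/(1-c) \<le> b/(1+c).\<close>

section \<open>Eccentricity and polar radius of a single ellipsoid\<close>

lemma c_delta_pos: "0 < c_delta t"
  unfolding c_delta_def using real_sqrt_less_mono[of "t\<^sup>2" "1 + t\<^sup>2"] by simp

lemma c_delta_less_1:
  assumes "0 < t" shows "c_delta t < 1"
proof -
  have "sqrt (1 + t\<^sup>2) < 1 + t"
    using assms by (intro real_less_lsqrt) (auto simp: power2_eq_square algebra_simps)
  then show ?thesis by (simp add: c_delta_def)
qed

text \<open>Squaring reduces the claim that sqrt(1 + t^2) grows by less than t - s to s < sqrt(1 +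
  s^2).\<close>

lemma c_delta_strict_antimono:
  assumes "0 \<le> s" "s < t" shows "c_delta t < c_delta s"
proof -
  have s: "s < sqrt (1 + s\<^sup>2)"
    using real_sqrt_less_mono[of "s\<^sup>2" "1 + s\<^sup>2"] by simp
  have "1 + t\<^sup>2 = 1 + s\<^sup>2 + (t - s)\<^sup>2 + 2 * (t - s) * s"
    by (simp add: power2_eq_square algebra_simps)
  also have "\<dots> < 1 + s\<^sup>2 + (t - s)\<^sup>2 + 2 * (t - s) * sqrt (1 + s\<^sup>2)"
    using s assms by simp
  also have "\<dots> = (sqrt (1 + s\<^sup>2) + (t - s))\<^sup>2"
    by (simp add: power2_sum)
  finally have "sqrt (1 + t\<^sup>2) < sqrt (1 + s\<^sup>2) + (t - s)"
    using assms by (intro real_less_lsqrt) (auto intro!: add_nonneg_nonneg)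
  then show ?thesis by (simp add: c_delta_def)
qed

text \<open>The eccentricity depends only on the ratio d/|P|. Hence \<open>c_delta \<delta>\<close>
  is the eccentricity at ratio \<delta>, and by antitonicity the largest one for d \<ge>
  \<delta>|P|.\<close>

lemma ecc_eq_c_delta: "ecc d P = c_delta (d / norm P)"
  by (simp add: ecc_def c_delta_def power_divide)

context
  fixes d :: real and P :: "real^3"
  assumes d: "0 < d" and P: "P \<noteq> 0"
begin

lemma ecc_pos: "0 < ecc d P"
  by (simp add: ecc_eq_c_delta c_delta_pos)

lemma ecc_less_1: "ecc d P < 1"
  using d P by (simp add: ecc_eq_c_delta c_delta_less_1)

lemma ecc_le_c_delta:
  assumes "0 < \<delta>" "\<delta> * norm P \<le> d" shows "ecc d P \<le> c_delta \<delta>"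
proof -
  have "\<delta> \<le> d / norm P" using assms P by (simp add: field_simps)
  then show ?thesis
    unfolding ecc_eq_c_delta
    using c_delta_strict_antimono[of \<delta> "d / norm P"] assms(1) by fastforce
qed

lemma abs_inner_sgn_le_1: "norm (x::real^3) = 1 \<Longrightarrow> \<bar>x \<bullet> sgn P\<bar> \<le> 1"
  using Cauchy_Schwarz_ineq2[of x "sgn P"] P by (simp add: norm_sgn)

lemma denom_bounds:
  assumes "norm x = 1"
  shows "1 - ecc d P \<le> 1 - ecc d P * (x \<bullet> sgn P)" "1 - ecc d P * (x \<bullet> sgn P) \<le> 1 + ecc d P"
    "0 < 1 - ecc d P * (x \<bullet> sgn P)"
proof -
  have "\<bar>ecc d P * (x \<bullet> sgn P)\<bar> \<le> ecc d P"
    using abs_inner_sgn_le_1[OF assms] ecc_pos by (simp add: abs_mult mult_left_le)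
  then show "1 - ecc d P \<le> 1 - ecc d P * (x \<bullet> sgn P)" "1 - ecc d P * (x \<bullet> sgn P) \<le> 1 + ecc d P"
    "0 < 1 - ecc d P * (x \<bullet> sgn P)"
    using ecc_less_1 by linarith+
qed

lemma polar_radius_pos: "norm x = 1 \<Longrightarrow> 0 < polar_radius d P x"
  unfolding polar_radius_def using denom_bounds d by simp

lemma polar_radius_bounds:
  assumes "norm x = 1" "0 < \<delta>" "\<delta> * norm P \<le> d"
  shows "d / (1 + c_delta \<delta>) \<le> polar_radius d P x" "polar_radius d P x \<le> d / (1 - c_delta \<delta>)"
  unfolding polar_radius_def using denom_bounds[OF assms(1)] ecc_le_c_delta[OF assms(2,3)] d
    c_delta_less_1[OF assms(2)]
  by (intro divide_left_mono mult_pos_pos; linarith)+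

lemma continuous_on_polar_radius: "continuous_on (sphere 0 1) (polar_radius d P)"
  unfolding polar_radius_def
  using denom_bounds by (intro continuous_intros) (auto simp: less_imp_neq[THEN not_sym])

end

text \<open>This compares polar radii in the direction of P itself. After cancelling d d'/r it reads
  d'(s - 1) < d(s' - 1); writing s - 1 as (d/r)^2/(s + 1) turns it into the easier d(s' + 1) < d'(s
  + 1).\<close>

lemma ecc_cross_strict_mono:
  assumes "0 < d" "d < d'" "P \<noteq> 0"
  shows "d * (1 - ecc d' P) < d' * (1 - ecc d P)"
proof -
  define r where "r = norm P"
  define s s' where "s = sqrt (1 + (d / r)\<^sup>2)" and "s' = sqrt (1 + (d' / r)\<^sup>2)"
  have r: "r > 0" using assms by (simp add: r_def)
  have "d * sqrt (1 + (d' / r)\<^sup>2) < d' * sqrt (1 + (d / r)\<^sup>2)"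
  proof -
    have "sqrt (d\<^sup>2 * (1 + (d' / r)\<^sup>2)) < sqrt (d'\<^sup>2 * (1 + (d / r)\<^sup>2))"
      using assms power_strict_mono[of d d' 2] by (auto simp: algebra_simps power_divide)
    then show ?thesis using assms by (simp add: real_sqrt_mult)
  qed
  then have less: "d * (s' + 1) < d' * (s + 1)" using assms by (simp add: s_def s'_def algebra_simps)
  have s: "(s - 1) * (s + 1) = (d / r)\<^sup>2" "(s' - 1) * (s' + 1) = (d' / r)\<^sup>2" "s > 0" "s' > 0"
    by (auto simp: s_def s'_def algebra_simps add_pos_nonneg)
  have "d' * (s - 1) = d' * (d / r)\<^sup>2 / (s + 1)"
    using s by (simp flip: s(1))
  also have "\<dots> < d * (d' / r)\<^sup>2 / (s' + 1)"
  proof -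
    have "d' * (d / r)\<^sup>2 * (s' + 1) = (d * d' / r\<^sup>2) * (d * (s' + 1))"
      by (simp add: power2_eq_square field_simps)
    also have "\<dots> < (d * d' / r\<^sup>2) * (d' * (s + 1))"
      using less assms r by (intro mult_strict_left_mono) auto
    also have "\<dots> = d * (d' / r)\<^sup>2 * (s + 1)"
      by (simp add: power2_eq_square field_simps)
    finally have *: "d' * (d / r)\<^sup>2 * (s' + 1) < d * (d' / r)\<^sup>2 * (s + 1)" .
    have "a / (s + 1) < b / (s' + 1)" if "a * (s' + 1) < b * (s + 1)" for a b
      using that s by (simp add: field_simps)
    then show ?thesis using * by blast
  qed
  also have "\<dots> = d * (s' - 1)"
    using s by (simp flip: s(2))
  finally show ?thesis
    using r by (simp add: ecc_eq_c_delta c_delta_def s_def s'_def r_def[symmetric] algebra_simps)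
qed

text \<open>Cross-multiplied, the claim is affine in c = \<open>x \<bullet> sgn P\<close>, and the
  sign of the slope makes c = 1 the worst case, which is
  \<open>ecc_cross_strict_mono\<close>.\<close>

lemma polar_radius_strict_mono:
  assumes "0 < d" "d < d'" "P \<noteq> 0" "norm x = 1"
  shows "polar_radius d P x < polar_radius d' P x"
proof -
  define c where "c = x \<bullet> sgn P"
  have c: "\<bar>c\<bar> \<le> 1" unfolding c_def using assms by (intro abs_inner_sgn_le_1)
  have e: "ecc d' P < ecc d P"
    unfolding ecc_eq_c_delta using assms by (intro c_delta_strict_antimono) (auto simp: divide_strict_right_mono)
  have *: "d * ecc d' P < d' * ecc d P"
    using e assms ecc_pos[of d P] ecc_pos[of d' P] by (intro mult_strict_mono) auto
  have "c * (d' * ecc d P - d * ecc d' P) \<le> 1 * (d' * ecc d P - d * ecc d' P)"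
    using c * by (intro mult_right_mono) auto
  then have "d * (1 - ecc d' P * c) < d' * (1 - ecc d P * c)"
    using ecc_cross_strict_mono[OF assms(1-3)] by (simp add: algebra_simps)
  then show ?thesis
    unfolding polar_radius_def c_def[symmetric]
    using denom_bounds(3)[of d P x] denom_bounds(3)[of d' P x] assms
    by (simp add: c_def field_simps)
qed

lemma tendsto_ecc:
  assumes "(d \<longlongrightarrow> d0) F"
  shows "((\<lambda>n. ecc (d n) P) \<longlongrightarrow> ecc d0 P) F"
  unfolding ecc_def divide_inverse by (intro tendsto_intros assms)

lemma tendsto_polar_radius:
  assumes "(d \<longlongrightarrow> d0) F" "0 < d0" "P \<noteq> 0" "norm x = 1"
  shows "((\<lambda>n. polar_radius (d n) P x) \<longlongrightarrow> polar_radius d0 P x) F"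
  unfolding polar_radius_def using denom_bounds(3)[of d0 P x] assms
  by (intro tendsto_intros tendsto_ecc) auto

section \<open>Null sets of the sphere measure\<close>

text \<open>For 0 \<le> c < |u| the cone lies in the frontier of a convex set; for c \<ge> |u|
  Cauchy-Schwarz confines it to a line; negative c reduces to these by reversing u.\<close>

lemma negligible_circular_cone:
  fixes u :: "real^3"
  assumes "u \<noteq> 0"
  shows "negligible {y. y \<bullet> u = c * norm y}"
proof -
  have nonneg: "negligible {y. y \<bullet> u = c * norm y}" if u: "u \<noteq> 0" and "c \<ge> 0" for c and u :: "real^3"
  proof (cases "c < norm u")
    case True
    define S where "S = {y. c * norm y \<le> y \<bullet> u}"
    have "convex S"
    proof (rule convexI)
      fix x y and a b :: real
      assume xy: "x \<in> S" "y \<in> S" and ab: "0 \<le> a" "0 \<le> b"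
      have "c * norm (a *\<^sub>R x + b *\<^sub>R y) \<le> c * (a * norm x + b * norm y)"
        using norm_triangle_ineq[of "a *\<^sub>R x" "b *\<^sub>R y"] ab \<open>c \<ge> 0\<close>
        by (intro mult_left_mono) auto
      also have "\<dots> = a * (c * norm x) + b * (c * norm y)" by (simp add: algebra_simps)
      also have "\<dots> \<le> a * (x \<bullet> u) + b * (y \<bullet> u)"
        using xy ab by (intro add_mono mult_left_mono) (auto simp: S_def)
      finally show "a *\<^sub>R x + b *\<^sub>R y \<in> S" by (simp add: S_def inner_simps)
    qed
    have "{y. y \<bullet> u = c * norm y} \<subseteq> frontier S"
    proof safe
      fix y assume y: "y \<bullet> u = c * norm y"
      have "y \<notin> interior S"
      proof
        assume "y \<in> interior S"
        then obtain e where e: "e > 0" "ball y e \<subseteq> S" by (auto simp: mem_interior)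
        \<comment> \<open>A step against u lowers \<open>y \<bullet> u\<close> by t|u|^2 but c|y| by
          at most ct|u|, which is less, so the new point violates the inequality defining S. The
          size of t keeps it inside the ball.\<close>
        define t where "t = e / (2 * norm u)"
        have t: "t > 0" "t * norm u < e" using e u by (auto simp: t_def)
        have "y - t *\<^sub>R u \<in> S" using e(2) t by (auto simp: dist_norm)
        then have "c * norm (y - t *\<^sub>R u) \<le> y \<bullet> u - t * (norm u)\<^sup>2"
          by (simp add: S_def inner_diff_left dot_square_norm)
        moreover have "c * norm y \<le> c * (norm (y - t *\<^sub>R u) + t * norm u)"
          using norm_triangle_ineq[of "y - t *\<^sub>R u" "t *\<^sub>R u"] t \<open>c \<ge> 0\<close>
          by (intro mult_left_mono) auto
        ultimately have "t * norm u * norm u \<le> t * norm u * c"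
          using y by (simp add: algebra_simps power2_eq_square)
        then show False using t u True by simp
      qed
      then show "y \<in> frontier S"
        using y closure_subset[of S] by (auto simp: frontier_def S_def)
    qed
    then show ?thesis
      using negligible_convex_frontier[OF \<open>convex S\<close>] negligible_subset by blast
  next
    case False
    have "{y. y \<bullet> u = c * norm y} \<subseteq> span {u}"
    proof safe
      fix y assume y: "y \<bullet> u = c * norm y"
      show "y \<in> span {u}"
      proof (cases "y = 0")
        case True then show ?thesis by (simp add: span_zero)
      next
        case nz: False
        have "norm y * norm u \<le> y \<bullet> u" using False y mult_right_mono[of "norm u" c "norm y"] by (simp add: mult.commute)
        then have "y \<bullet> u = norm y * norm u" using norm_cauchy_schwarz[of y u] by linarith
        then have "norm y *\<^sub>R u = norm u *\<^sub>R y" by (simp add: norm_cauchy_schwarz_eq)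
        then have "(1 / norm u) *\<^sub>R (norm u *\<^sub>R y) = (1 / norm u) *\<^sub>R (norm y *\<^sub>R u)" by simp
        then have "y = (norm y / norm u) *\<^sub>R u" using u by simp
        then show ?thesis by (metis span_base span_scale insertI1)
      qed
    qed
    moreover have "negligible (span {u})"
      by (rule negligible_lowdim) (use u in \<open>simp add: dim_span dim_insert\<close>)
    ultimately show ?thesis using negligible_subset by blast
  qed
  show ?thesis
  proof (cases "c \<ge> 0")
    case True then show ?thesis using nonneg assms by blast
  next
    case False
    then have "{y. y \<bullet> u = c * norm y} = {y. y \<bullet> (- u) = (- c) * norm y}" by auto
    then show ?thesis using nonneg[of "- u" "- c"] assms False by simp
  qed
qed

lemma sets_sphere_measure_borel:
  assumes "A \<in> sets borel" "A \<subseteq> sphere 0 1" shows "A \<in> sets sphere_measure"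
  unfolding sphere_measure_def using assms
  by (intro sets_completionI_sets) (auto simp: sets_restrict_space_iff)

lemma borel_measurable_sphere_continuous:
  fixes h :: "real^3 \<Rightarrow> real"
  assumes "continuous_on (sphere 0 1) h"
  shows "h \<in> borel_measurable sphere_measure"
  unfolding sphere_measure_def
  by (intro measurable_completion, subst measurable_cong_sets)
     (auto intro: borel_measurable_continuous_on_restrict assms)

text \<open>The sphere measure is a multiple of the image of volume under radial projection, so
  nullity becomes negligibility of the cone over A in space.\<close>

lemma null_sets_sphere_measureI:
  assumes "A \<in> sets borel" "A \<subseteq> sphere 0 1" "negligible {y. sgn y \<in> A}"
  shows "A \<in> null_sets sphere_measure"
proof -
  let ?B = "cball (0::real^3) 1 - {0}"
  let ?D = "distr (restrict_space lborel ?B) (restrict_space borel (sphere 0 1)) sgn"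
  have A: "A \<in> sets (restrict_space borel (sphere 0 1))"
    using assms by (auto simp: sets_restrict_space_iff)
  have "emeasure ?D A = emeasure (restrict_space lborel ?B) (sgn -` A \<inter> ?B)"
    using A by (subst emeasure_distr[OF measurable_sgn_sphere]) (auto simp: space_restrict_space)
  also have "\<dots> = emeasure lborel (sgn -` A \<inter> ?B)"
    by (subst emeasure_restrict_space) auto
  also have "\<dots> = 0"
  proof -
    have "sgn -` A \<inter> ?B \<in> sets lborel"
      using measurable_sets[OF measurable_sgn_sphere A]
      by (auto simp: space_restrict_space sets_restrict_space_iff)
    moreover have "negligible (sgn -` A \<inter> ?B)"
      by (rule negligible_subset[OF assms(3)]) auto
    ultimately have "sgn -` A \<inter> ?B \<in> null_sets lborel"
      by (simp add: negligible_iff_null_sets null_sets_completion_iff)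
    then show ?thesis by auto
  qed
  finally have "A \<in> null_sets (scale_measure 3 ?D)"
    using A by (intro null_setsI) (auto simp: emeasure_scale_measure)
  then show ?thesis
    unfolding sphere_measure_def by (rule null_sets_completionI)
qed

lemma null_sets_sphere_circle:
  assumes "u \<noteq> 0 \<or> c \<noteq> 0"
  shows "{x \<in> sphere 0 1. x \<bullet> u = c} \<in> null_sets sphere_measure"
proof (cases "u = 0")
  case True
  then show ?thesis using assms by simp
next
  case False
  show ?thesis
  proof (rule null_sets_sphere_measureI)
    have "closed {x \<in> sphere (0::real^3) 1. x \<bullet> u = c}"
    proof -
      have "{x \<in> sphere (0::real^3) 1. x \<bullet> u = c} = sphere 0 1 \<inter> {x. u \<bullet> x = c}"
        by (auto simp: inner_commute)
      then show ?thesis by (simp add: closed_Int closed_hyperplane)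
    qed
    then show "{x \<in> sphere (0::real^3) 1. x \<bullet> u = c} \<in> sets borel" by simp
    have "{y. sgn y \<in> {x \<in> sphere (0::real^3) 1. x \<bullet> u = c}} \<subseteq> {y. y \<bullet> u = c * norm y}"
    proof
      fix y assume "y \<in> {y. sgn y \<in> {x \<in> sphere (0::real^3) 1. x \<bullet> u = c}}"
      then have "sgn y \<bullet> u = c" "y \<noteq> 0" by auto
      then show "y \<in> {y. y \<bullet> u = c * norm y}" by (auto simp: sgn_div_norm)
    qed
    then show "negligible {y. sgn y \<in> {x \<in> sphere (0::real^3) 1. x \<bullet> u = c}}"
      using negligible_circular_cone[OF False] negligible_subset by blast
  qed auto
qed

text \<open>Clearing denominators gives the linear equation \<open>x \<bullet> u = d - d'\<close>,
  hence a circle unless u and d - d' both vanish. In that case d = d', the two eccentricities and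
  axis directions agree, and strict monotonicity of the eccentricity in d/|P| forces P = P'.\<close>

lemma null_sets_polar_radius_eq:
  assumes "0 < d" "0 < d'" "P \<noteq> 0" "P' \<noteq> 0" "P \<noteq> P'"
  shows "{x \<in> sphere 0 1. polar_radius d P x = polar_radius d' P' x} \<in> null_sets sphere_measure"
proof -
  define u where "u = (d * ecc d' P') *\<^sub>R sgn P' - (d' * ecc d P) *\<^sub>R sgn P"
  have "{x \<in> sphere 0 1. polar_radius d P x = polar_radius d' P' x} = {x \<in> sphere 0 1. x \<bullet> u = d - d'}"
  proof (intro Collect_cong conj_cong refl)
    fix x :: "real^3" assume "x \<in> sphere 0 1"
    then show "polar_radius d P x = polar_radius d' P' x \<longleftrightarrow> x \<bullet> u = d - d'"
      using denom_bounds(3)[of d P x] denom_bounds(3)[of d' P' x] assms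
      by (auto simp: polar_radius_def u_def inner_diff_right field_simps)
  qed
  moreover have "u \<noteq> 0 \<or> d - d' \<noteq> 0"
  proof (rule ccontr)
    assume "\<not> ?thesis"
    then have dd: "d' = d" and "ecc d P' *\<^sub>R sgn P' = ecc d P *\<^sub>R sgn P"
      using assms by (auto simp: u_def simp flip: scaleR_scaleR)
    then have eq: "ecc d P' *\<^sub>R sgn P' = ecc d P *\<^sub>R sgn P" by simp
    then have "norm (ecc d P' *\<^sub>R sgn P') = norm (ecc d P *\<^sub>R sgn P)" by simp
    then have e: "ecc d P' = ecc d P"
      using assms ecc_pos[of d P] ecc_pos[of d P'] by (simp add: norm_sgn)
    then have s: "sgn P' = sgn P" using eq ecc_pos[of d P] assms by simp
    have "d / norm P' = d / norm P"
      using e c_delta_strict_antimono[of "d / norm P" "d / norm P'"]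
        c_delta_strict_antimono[of "d / norm P'" "d / norm P"] assms
      unfolding ecc_eq_c_delta by (cases "d / norm P" "d / norm P'" rule: linorder_cases) auto
    then have "norm P' = norm P" using assms by simp
    then have "P' = P" using s assms by (simp add: sgn_div_norm)
    then show False using assms by simp
  qed
  ultimately show ?thesis using null_sets_sphere_circle[of u "d - d'"] by simp
qed

section \<open>The outer normal of a radial graph\<close>

text \<open>Uniqueness needs enough secants: if S contains a curve leaving p in every direction
  orthogonal to n0, any other candidate is orthogonal to all of them, hence parallel to n0, and the
  condition of pointing away from the origin fixes the sign.\<close>

lemma outer_unit_normal_eqI:
  assumes normal: "is_outer_unit_normal S p n0"
    and curves: "\<And>v. v \<bullet> n0 = 0 \<Longrightarrow> v \<noteq> 0 \<Longrightarrow>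
      \<exists>q. filterlim q (at p within S) (at_right (0::real)) \<and> ((\<lambda>t. (q t - p) /\<^sub>R t) \<longlongrightarrow> v) (at_right 0)"
  shows "outer_unit_normal S p = n0"
  unfolding outer_unit_normal_def
proof (rule the_equality[where P = "is_outer_unit_normal S p", OF normal])
  fix n assume n: "is_outer_unit_normal S p n"
  have orth: "n \<bullet> v = 0" if v: "v \<bullet> n0 = 0" for v
  proof (cases "v = 0")
    case False
    obtain q where q: "filterlim q (at p within S) (at_right (0::real))"
      and q': "((\<lambda>t. (q t - p) /\<^sub>R t) \<longlongrightarrow> v) (at_right 0)"
      using curves[OF v False] by blast
    have lim0: "((\<lambda>t. n \<bullet> sgn (q t - p)) \<longlongrightarrow> 0) (at_right 0)"
      using n q filterlim_compose unfolding is_outer_unit_normal_def by blast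
    have "((\<lambda>t. n \<bullet> sgn ((q t - p) /\<^sub>R t)) \<longlongrightarrow> n \<bullet> sgn v) (at_right 0)"
      by (intro tendsto_intros q' False)
    moreover have "eventually (\<lambda>t. n \<bullet> sgn ((q t - p) /\<^sub>R t) = n \<bullet> sgn (q t - p)) (at_right 0)"
      using eventually_at_right_less[of "0::real"]
      by eventually_elim (simp add: sgn_scaleR)
    ultimately have "((\<lambda>t. n \<bullet> sgn (q t - p)) \<longlongrightarrow> n \<bullet> sgn v) (at_right 0)"
      by (rule Lim_transform_eventually)
    then have "n \<bullet> sgn v = 0"
      using tendsto_unique[OF trivial_limit_at_right_real] lim0 by blast
    then show ?thesis using False by (simp add: sgn_div_norm)
  qed auto
  have n0: "norm n0 = 1" "n0 \<bullet> p > 0" and n1: "norm n = 1" "n \<bullet> p > 0"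
    using n normal by (auto simp: is_outer_unit_normal_def)
  define v where "v = n - (n \<bullet> n0) *\<^sub>R n0"
  have "v \<bullet> n0 = 0" using n0 by (simp add: v_def inner_diff_left dot_square_norm)
  then have "v \<bullet> v = 0"
    using orth[of v] by (simp add: v_def inner_simps inner_commute)
  then have eq: "n = (n \<bullet> n0) *\<^sub>R n0" by (simp add: v_def)
  then have "\<bar>n \<bullet> n0\<bar> = 1" using n0 n1 by (metis norm_scaleR mult.right_neutral)
  moreover have "n \<bullet> n0 > 0"
    using n0 n1 eq by (metis inner_scaleR_left zero_less_mult_pos2)
  ultimately show "n = n0" using eq by simp
qed

text \<open>Over U the surface is the level set F = d of the positively homogeneous function F y =
  |y| - e (y \<bullet> m), whose gradient at p is x - e m; normalised, this gradient is the
  normal.\<close>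

lemma outer_unit_normal_radial_graph:
  assumes d: "0 < d" and P: "P \<noteq> 0" and X: "X \<subseteq> sphere 0 1" and pos: "\<And>y. y \<in> X \<Longrightarrow> \<rho> y > 0"
    and U: "openin sphere_top U" "U \<subseteq> X" "x \<in> U"
    and eq: "\<And>y. y \<in> U \<Longrightarrow> \<rho> y = polar_radius d P y"
  shows "outer_unit_normal (radial_graph X \<rho>) (\<rho> x *\<^sub>R x) = sgn (x - ecc d P *\<^sub>R sgn P)"
proof -
  define S p e m where "S = radial_graph X \<rho>" and "p = \<rho> x *\<^sub>R x" and "e = ecc d P" and "m = sgn P"
  define F where "F y = norm y - e * (y \<bullet> m)" for y :: "real^3"
  define u where "u = x - e *\<^sub>R m"
  have e: "0 < e" "e < 1" using ecc_pos ecc_less_1 d P by (auto simp: e_def)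
  have x: "norm x = 1" "x \<in> X" using U X by auto
  have p0: "p \<noteq> 0" using pos[of x] x by (auto simp: p_def)
  have "sgn p = x" using pos[of x] x by (simp add: p_def sgn_scaleR sgn_div_norm)
  have xu: "x \<bullet> u > 0"
    using denom_bounds(3)[OF d P x(1)] x by (simp add: u_def e_def m_def inner_diff_right dot_square_norm)
  then have u0: "u \<noteq> 0" by auto
  obtain T where T: "open T" "U = sphere 0 1 \<inter> T" using U(1) by (auto simp: openin_open)
  have F_scaled: "F y > 0" "polar_radius d P (sgn y) *\<^sub>R sgn y = (d / F y) *\<^sub>R y" if "y \<noteq> 0" for y
  proof -
    have *: "F y = norm y * (1 - e * (sgn y \<bullet> m))" using that by (simp add: F_def sgn_div_norm field_simps)
    then show "F y > 0"
      using that denom_bounds(3)[OF d P, of "sgn y"] by (simp add: norm_sgn e_def m_def)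
    show "polar_radius d P (sgn y) *\<^sub>R sgn y = (d / F y) *\<^sub>R y"
      using that unfolding * polar_radius_def by (simp add: e_def m_def sgn_div_norm field_simps)
  qed
  have F_S: "F (\<rho> y *\<^sub>R y) = d" if "y \<in> U" for y
  proof -
    have "norm y = 1" "\<rho> y > 0" using that U X pos by auto
    then have "F (\<rho> y *\<^sub>R y) = \<rho> y * (1 - e * (y \<bullet> m))" by (simp add: F_def algebra_simps)
    also have "\<dots> = d"
      using eq[OF that] denom_bounds(3)[OF d P \<open>norm y = 1\<close>] by (simp add: polar_radius_def e_def m_def)
    finally show ?thesis .
  qed
  then have Fp: "F p = d" using U by (simp add: p_def)
  have F': "(F has_derivative (\<lambda>h. u \<bullet> h)) (at p)"
  proof -
    have "(F has_derivative (\<lambda>h. h \<bullet> sgn p - e * (h \<bullet> m))) (at p)"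
      unfolding F_def by (auto intro!: derivative_eq_intros has_derivative_norm p0)
    then show ?thesis
      by (rule has_derivative_eq_rhs) (auto simp: u_def \<open>sgn p = x\<close> inner_simps inner_commute)
  qed
  have sgn_T: "eventually (\<lambda>y. sgn y \<in> T) (nhds p)"
  proof -
    have "(sgn \<longlongrightarrow> sgn p) (nhds p)"
      by (intro tendsto_sgn p0) (simp add: filterlim_ident)
    moreover have "sgn p \<in> T" using U T by (simp add: \<open>sgn p = x\<close>)
    ultimately show ?thesis using T(1) topological_tendstoD by fast
  qed
  have "is_outer_unit_normal S p (sgn u)"
    unfolding is_outer_unit_normal_def
  proof (intro conjI)
    show "norm (sgn u) = 1" using u0 by (simp add: norm_sgn)
    show "sgn u \<bullet> p > 0"
      using xu u0 pos[of x] x by (simp add: sgn_div_norm p_def inner_commute)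
    have "((\<lambda>q. (F q - (F p + u \<bullet> (q - p))) / norm (q - p)) \<longlongrightarrow> 0) (at p within S)"
      using has_derivative_at_withinI[OF F', of S]
      by (simp add: has_derivative_within)
    \<comment> \<open>Near p every point of S satisfies F q = F p, so the difference quotient is
      just - u \<bullet> sgn (q - p); the factor -1/|u| turns it into the secant condition for
      \<open>sgn u\<close>.\<close>
    then have "((\<lambda>q. (F q - (F p + u \<bullet> (q - p))) / norm (q - p) * (- 1 / norm u)) \<longlongrightarrow> 0 * (- 1 / norm u)) (at p within S)"
      by (intro tendsto_mult tendsto_const)
    moreover have "eventually (\<lambda>q. (F q - (F p + u \<bullet> (q - p))) / norm (q - p) * (- 1 / norm u)
        = sgn u \<bullet> sgn (q - p)) (at p within S)"
    proof -
      have "eventually (\<lambda>q. q \<in> S) (at p within S)" by (simp add: eventually_at_filter)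
      moreover have "eventually (\<lambda>q. sgn q \<in> T) (at p within S)"
        using sgn_T filter_leD[OF at_within_le_nhds] by blast
      ultimately show ?thesis
      proof eventually_elim
        case (elim q)
        then obtain y where y: "y \<in> X" "q = \<rho> y *\<^sub>R y" by (auto simp: S_def radial_graph_def)
        have "norm y = 1" using y X by auto
        then have "sgn q = y" using pos[OF y(1)] by (simp add: y(2) sgn_scaleR sgn_div_norm)
        then have "y \<in> U" using elim T \<open>norm y = 1\<close> by auto
        then have "F q = d" using F_S y by simp
        then show ?case using Fp by (simp add: sgn_div_norm divide_inverse)
      qed
    qed
    ultimately show "((\<lambda>q. sgn u \<bullet> sgn (q - p)) \<longlongrightarrow> 0) (at p within S)"
      using tendsto_cong by force
  qed
  moreover have "\<exists>q. filterlim q (at p within S) (at_right (0::real)) \<and>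
      ((\<lambda>t. (q t - p) /\<^sub>R t) \<longlongrightarrow> v) (at_right 0)"
    if v: "v \<bullet> sgn u = 0" "v \<noteq> 0" for v
  proof -
    \<comment> \<open>The tangent line through p is pushed radially onto the level set F = d. Since
      v is orthogonal to the gradient u, the rescaling factor has derivative 0 at t = 0 and the
      curve still leaves p with velocity v.\<close>
    define q where "q t = (d / F (p + t *\<^sub>R v)) *\<^sub>R (p + t *\<^sub>R v)" for t
    have q0: "q 0 = p" using Fp d by (simp add: q_def)
    have uv: "u \<bullet> v = 0" using v u0 by (simp add: sgn_div_norm inner_commute)
    have "((\<lambda>t. F (p + t *\<^sub>R v)) has_derivative (\<lambda>t. u \<bullet> (t *\<^sub>R v))) (at 0)"
      by (rule has_derivative_compose[where g = F, of "\<lambda>t. p + t *\<^sub>R v"])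
         (auto intro!: derivative_eq_intros F')
    then have "(q has_derivative (\<lambda>t. t *\<^sub>R v)) (at 0)"
      unfolding q_def using d Fp by (auto intro!: derivative_eq_intros simp: uv)
    then have q': "(q has_derivative (\<lambda>t. t *\<^sub>R v)) (at 0 within {0<..})"
      by (rule has_derivative_at_withinI)
    then have "((\<lambda>t. (1 / norm (t - 0)) *\<^sub>R (q t - (q 0 + (t - 0) *\<^sub>R v))) \<longlongrightarrow> 0) (at_right 0)"
      by (simp add: has_derivative_within)
    moreover have "eventually (\<lambda>t. (1 / norm (t - 0)) *\<^sub>R (q t - (q 0 + (t - 0) *\<^sub>R v))
        = (q t - p) /\<^sub>R t - v) (at_right 0)"
      using eventually_at_right_less[of "0::real"]
      by eventually_elim (simp add: q0 scaleR_diff_right divide_inverse flip: diff_diff_eq)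
    ultimately have "((\<lambda>t. (q t - p) /\<^sub>R t - v) \<longlongrightarrow> 0) (at_right 0)"
      by (rule Lim_transform_eventually)
    then have lim: "((\<lambda>t. (q t - p) /\<^sub>R t) \<longlongrightarrow> v) (at_right 0)"
      by (rule LIM_zero_cancel)
    have to_p: "((\<lambda>t. p + t *\<^sub>R v) \<longlongrightarrow> p) (at_right 0)"
      by (auto intro!: tendsto_eq_intros)
    have "filterlim q (at p within S) (at_right 0)"
      unfolding filterlim_at
    proof
      have "(q \<longlongrightarrow> q 0) (at 0 within {0<..})"
        using has_derivative_continuous[OF q'] by (simp add: continuous_within)
      then show "(q \<longlongrightarrow> p) (at_right 0)" by (simp add: q0)
      have "eventually (\<lambda>t. (q t - p) /\<^sub>R t \<noteq> 0) (at_right 0)"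
        using tendsto_imp_eventually_ne[OF lim v(2)] .
      moreover have "eventually (\<lambda>t. p + t *\<^sub>R v \<noteq> 0) (at_right 0)"
        using tendsto_imp_eventually_ne[OF to_p p0] .
      moreover have "eventually (\<lambda>t. sgn (p + t *\<^sub>R v) \<in> T) (at_right 0)"
        using to_p sgn_T unfolding filterlim_iff by blast
      ultimately show "eventually (\<lambda>t. q t \<in> S \<and> q t \<noteq> p) (at_right 0)"
      proof eventually_elim
        case (elim t)
        define y where "y = sgn (p + t *\<^sub>R v)"
        have y: "y \<in> U" using elim T by (auto simp: y_def norm_sgn)
        have "q t = \<rho> y *\<^sub>R y"
          using F_scaled(2)[of "p + t *\<^sub>R v"] elim eq[OF y] by (simp add: q_def y_def)
        then show ?case using elim y U by (auto simp: S_def radial_graph_def)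
      qed
    qed
    then show ?thesis using lim by blast
  qed
  ultimately show ?thesis
    unfolding S_def[symmetric] p_def[symmetric] e_def[symmetric] m_def[symmetric] u_def[symmetric]
    by (rule outer_unit_normal_eqI)
qed

section \<open>Almost everywhere modifications, and the kernel of one ellipsoid\<close>

lemma borel_measurable_completion_cong_AE:
  fixes f g :: "'a \<Rightarrow> real"
  assumes "f \<in> borel_measurable (completion M)" "AE x in completion M. f x = g x"
  shows "g \<in> borel_measurable (completion M)"
proof (rule measurableI)
  fix B :: "real set" assume "B \<in> sets borel"
  then have "f -` B \<inter> space (completion M) \<in> sets (completion M)"
    using assms(1) measurable_sets by blast
  moreover have "AE x in completion M.
      x \<in> f -` B \<inter> space (completion M) \<longleftrightarrow> x \<in> g -` B \<inter> space (completion M)"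
    using assms(2) by eventually_elim simp
  ultimately show "g -` B \<inter> space (completion M) \<in> sets (completion M)"
    using completion.in_sets_AE by blast
qed simp

text \<open>Completeness of the measure transfers measurability along almost everywhere equality.
  The integrand of \<open>refl_measure\<close>, built from \<open>tau\<close> and a
  \<open>THE\<close>, is reached in this way from an explicit one.\<close>

lemma integral_sphere_measure_cong_AE:
  fixes f g :: "real^3 \<Rightarrow> real"
  assumes "f \<in> borel_measurable sphere_measure" "AE x in sphere_measure. f x = g x"
  shows "(LINT x|sphere_measure. f x) = (LINT x|sphere_measure. g x)"
proof (rule integral_cong_AE[OF assms(1) _ assms(2)])
  show "g \<in> borel_measurable sphere_measure"
    using assms borel_measurable_completion_cong_AE unfolding sphere_measure_def by blast
qed

text \<open>The factor \<open>(x \<bullet> \<nu>) / \<rho>\<^sup>2\<close> of the reflector measure for the single ellipsoid \<open>E\<^sub>d(P)\<close>.\<close>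

definition ellipsoid_kernel :: "real \<Rightarrow> real^3 \<Rightarrow> real^3 \<Rightarrow> real" where
  "ellipsoid_kernel d P x = (x \<bullet> sgn (x - ecc d P *\<^sub>R sgn P)) / (polar_radius d P x)\<^sup>2"

text \<open>The inner product is (1 - e (x \<bullet> m))/n with numerator at least 1 - e and n \<le>
  1 + e. The two extremes occur in opposite directions m and -m, so the bound is strict; this
  strictness is what finally gives the first focus more than its share.\<close>

lemma inner_sgn_normal_gt:
  fixes x m :: "'a::real_inner"
  assumes "norm x = 1" "norm m = 1" "0 < e" "e < 1"
  shows "(1 - e) / (1 + e) < x \<bullet> sgn (x - e *\<^sub>R m)"
proof -
  define n where "n = norm (x - e *\<^sub>R m)"
  have t: "x \<bullet> m \<le> 1" using norm_cauchy_schwarz[of x m] assms by simp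
  have n_le: "n \<le> 1 + e" using norm_triangle_ineq4[of x "e *\<^sub>R m"] assms by (simp add: n_def)
  have n_ge: "1 - e \<le> n" using norm_triangle_ineq2[of x "e *\<^sub>R m"] assms by (simp add: n_def)
  have "x \<bullet> x = 1" "m \<bullet> m = 1" using assms by (simp_all add: dot_square_norm)
  then have n2: "n\<^sup>2 = 1 - 2 * e * (x \<bullet> m) + e\<^sup>2"
    unfolding n_def power2_norm_eq_inner
    by (simp add: inner_diff_left inner_diff_right inner_commute power2_eq_square)
  have "(1 - e) * n < (1 + e) * (1 - e * (x \<bullet> m))"
  proof (cases "x \<bullet> m = 1")
    case True
    then have "n\<^sup>2 = (1 - e)\<^sup>2" using n2 by (simp add: power2_eq_square algebra_simps)
    then have "n = 1 - e" using assms n_ge by (simp add: power2_eq_iff)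
    then show ?thesis using True assms by (simp add: mult_strict_right_mono)
  next
    case False
    have "(1 - e) * n \<le> (1 + e) * (1 - e)" using n_le assms by (simp add: mult.commute mult_left_mono)
    also have "\<dots> < (1 + e) * (1 - e * (x \<bullet> m))" using False t assms by (intro mult_strict_left_mono) auto
    finally show ?thesis .
  qed
  then have "(1 - e) / (1 + e) < (1 - e * (x \<bullet> m)) / n"
    using n_ge assms by (simp add: divide_simps mult.commute)
  moreover have "x \<bullet> sgn (x - e *\<^sub>R m) = (1 - e * (x \<bullet> m)) / n"
    using assms by (simp add: n_def sgn_div_norm inner_diff_right dot_square_norm divide_inverse algebra_simps)
  ultimately show ?thesis by simp
qed

context
  fixes d :: real and P :: "real^3"
  assumes d: "0 < d" and P: "P \<noteq> 0"
begin

lemma normal_nonzero: "norm (x::real^3) = 1 \<Longrightarrow> x - ecc d P *\<^sub>R sgn P \<noteq> 0"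
  using ecc_pos[OF d P] ecc_less_1[OF d P] P by (auto simp: norm_sgn)

lemma ellipsoid_kernel_gt:
  assumes "norm x = 1" "0 < \<delta>" "\<delta> * norm P \<le> d" "polar_radius d P x \<le> R"
  shows "(1 - c_delta \<delta>) / (1 + c_delta \<delta>) / R\<^sup>2 < ellipsoid_kernel d P x"
proof -
  define c e where "c = c_delta \<delta>" and "e = ecc d P"
  have e: "0 < e" "e < 1" "e \<le> c" "c < 1"
    using ecc_pos[OF d P] ecc_less_1[OF d P] ecc_le_c_delta[OF d P assms(2,3)] c_delta_less_1 assms(2)
    by (auto simp: c_def e_def)
  have pr: "0 < polar_radius d P x" using polar_radius_pos d P assms by blast
  have "(1 - c) / (1 + c) \<le> (1 - e) / (1 + e)" using e by (intro frac_le) auto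
  also have "\<dots> < x \<bullet> sgn (x - e *\<^sub>R sgn P)"
    using e assms P by (intro inner_sgn_normal_gt) (auto simp: norm_sgn)
  finally have less: "(1 - c) / (1 + c) < x \<bullet> sgn (x - e *\<^sub>R sgn P)" .
  have "(1 - c) / (1 + c) / R\<^sup>2 \<le> (1 - c) / (1 + c) / (polar_radius d P x)\<^sup>2"
    using pr assms(4) e by (intro divide_left_mono power_mono) auto
  also have "\<dots> < ellipsoid_kernel d P x"
    unfolding ellipsoid_kernel_def using less pr
    by (intro divide_strict_right_mono) (auto simp: e_def)
  finally show ?thesis by (simp add: c_def)
qed

text \<open>The denominator of the polar radius is below 2, so the radius is at least d/2. The
  resulting bound is uniform in x and decreasing in d, as domination of the mass integrals
  requires.\<close>

lemma ellipsoid_kernel_bounds: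
  assumes "norm x = 1"
  shows "0 \<le> ellipsoid_kernel d P x" "ellipsoid_kernel d P x \<le> 4 / d\<^sup>2"
proof -
  define e where "e = ecc d P"
  have e: "0 < e" "e < 1" using ecc_pos[OF d P] ecc_less_1[OF d P] by (auto simp: e_def)
  have pr: "0 < polar_radius d P x" using polar_radius_pos d P assms by blast
  have "0 < x \<bullet> sgn (x - e *\<^sub>R sgn P)"
    using inner_sgn_normal_gt[of x "sgn P" e] e assms P
    by (simp add: norm_sgn) (smt (verit) divide_pos_pos)
  then show "0 \<le> ellipsoid_kernel d P x" by (simp add: ellipsoid_kernel_def e_def)
  have "x \<bullet> sgn (x - e *\<^sub>R sgn P) \<le> 1"
    using norm_cauchy_schwarz[of x "sgn (x - e *\<^sub>R sgn P)"] assms by (simp add: norm_sgn split: if_splits)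
  then have "ellipsoid_kernel d P x \<le> 1 / (polar_radius d P x)\<^sup>2"
    by (simp add: ellipsoid_kernel_def e_def divide_right_mono)
  also have "d / 2 \<le> polar_radius d P x"
    unfolding polar_radius_def using denom_bounds[OF d P assms] ecc_less_1[OF d P] d
    by (intro divide_left_mono) auto
  then have "1 / (polar_radius d P x)\<^sup>2 \<le> 1 / (d / 2)\<^sup>2"
    using d by (intro divide_left_mono power_mono) auto
  finally show "ellipsoid_kernel d P x \<le> 4 / d\<^sup>2" by (simp add: power_divide)
qed

lemma continuous_on_ellipsoid_kernel: "continuous_on (sphere 0 1) (ellipsoid_kernel d P)"
  unfolding ellipsoid_kernel_def
  using polar_radius_pos[OF d P] normal_nonzero
  by (intro continuous_intros continuous_on_polar_radius d P)
     (auto simp: less_imp_neq[THEN not_sym])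

end

lemma tendsto_ellipsoid_kernel:
  assumes "(d \<longlongrightarrow> d0) F" "0 < d0" "P \<noteq> 0" "norm x = 1"
  shows "((\<lambda>n. ellipsoid_kernel (d n) P x) \<longlongrightarrow> ellipsoid_kernel d0 P x) F"
  unfolding ellipsoid_kernel_def
  using polar_radius_pos[of d0 P x] normal_nonzero[of d0 P x] assms
  by (intro tendsto_intros tendsto_ecc tendsto_polar_radius) auto

section \<open>Cells of a weight vector and their relation to the reflector measure\<close>

locale reflector_data =
  fixes \<Omega> X :: "(real^3) set" and f :: "real^3 \<Rightarrow> real" and N :: nat and P :: "nat \<Rightarrow> real^3"
  assumes Omega: "\<Omega> \<subseteq> sphere 0 1"
    and null_frontier: "sphere_top frontier_of \<Omega> \<in> null_sets sphere_measure"
    and X_def: "X = sphere_top closure_of \<Omega>"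
    and integrable_f: "set_integrable sphere_measure X f"
    and f_pos: "AE x in sphere_measure. x \<in> X \<longrightarrow> f x > 0"
    and N_pos: "N > 0"
    and inj_P: "inj_on P {1..N}"
    and P_nonzero: "i \<in> {1..N} \<Longrightarrow> P i \<noteq> 0"
begin

lemma X_subset: "X \<subseteq> sphere 0 1"
  using closure_of_subset_topspace[of sphere_top \<Omega>] by (simp add: X_def)

lemma norm_X: "x \<in> X \<Longrightarrow> norm x = 1"
  using X_subset by auto

lemma closed_X: "closed X"
  unfolding X_def by (metis closed_sphere closedin_closed_trans closedin_closure_of)

abbreviation (input) pr :: "(nat \<Rightarrow> real) \<Rightarrow> nat \<Rightarrow> real^3 \<Rightarrow> real" where
  "pr w i \<equiv> polar_radius (w i) (P i)"

text \<open>Here the ellipsoid of parameter \<open>w i\<close> itself must be innermost, whereas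
  \<open>tau\<close> accepts any ellipsoid with focus \<open>P i\<close>. A cell is thus cut out by
  finitely many inequalities between continuous functions.\<close>

definition cell :: "(nat \<Rightarrow> real) \<Rightarrow> nat \<Rightarrow> (real^3) set" where
  "cell w i = {x \<in> X. \<forall>j\<in>{1..N}. pr w i x \<le> pr w j x}"

definition cell_mass :: "(nat \<Rightarrow> real) \<Rightarrow> nat \<Rightarrow> real" where
  "cell_mass w i = (LINT x : cell w i | sphere_measure. f x * ellipsoid_kernel (w i) (P i) x)"

lemma rho_w_le: "j \<in> {1..N} \<Longrightarrow> rho_w N P w x \<le> pr w j x"
  unfolding rho_w_def by (intro Min_le) auto

lemma rho_w_attained: "\<exists>i\<in>{1..N}. rho_w N P w x = pr w i x"
proof -
  have "rho_w N P w x \<in> (\<lambda>i. pr w i x) ` {1..N}"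
    unfolding rho_w_def using N_pos by (intro Min_in) auto
  then show ?thesis by auto
qed

lemma mem_cell_iff:
  assumes "i \<in> {1..N}"
  shows "x \<in> cell w i \<longleftrightarrow> x \<in> X \<and> pr w i x = rho_w N P w x"
proof -
  have "(\<forall>j\<in>{1..N}. pr w i x \<le> pr w j x) \<longleftrightarrow> pr w i x = rho_w N P w x"
  proof
    assume le: "\<forall>j\<in>{1..N}. pr w i x \<le> pr w j x"
    obtain j where "j \<in> {1..N}" "rho_w N P w x = pr w j x" using rho_w_attained by blast
    then show "pr w i x = rho_w N P w x" using le rho_w_le[OF assms, of w x] by force
  next
    assume "pr w i x = rho_w N P w x"
    then show "\<forall>j\<in>{1..N}. pr w i x \<le> pr w j x" using rho_w_le[of _ w x] by simp
  qed
  then show ?thesis by (simp add: cell_def)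
qed

text \<open>Separates a fixed integrable factor from a bounded one that carries all dependence on
  the weights.\<close>

lemma cell_integrand_eq:
  "indicator (cell w i) x *\<^sub>R (f x * ellipsoid_kernel (w i) (P i) x)
    = (indicator X x *\<^sub>R f x) * (indicator (cell w i) x * ellipsoid_kernel (w i) (P i) x)"
  by (auto simp: cell_def indicator_def)

lemma AE_neq:
  assumes "i \<in> {1..N}" "j \<in> {1..N}" "i \<noteq> j" "0 < d" "0 < d'"
  shows "AE x in sphere_measure. polar_radius d (P i) x \<noteq> polar_radius d' (P j) x"
proof -
  have "P i \<noteq> P j" using inj_P assms by (auto dest: inj_onD)
  then have "{x \<in> sphere 0 1. polar_radius d (P i) x = polar_radius d' (P j) x} \<in> null_sets sphere_measure"
    using assms P_nonzero by (intro null_sets_polar_radius_eq) auto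
  from AE_not_in[OF this] AE_space show ?thesis
    by eventually_elim (auto simp: space_sphere_measure)
qed

text \<open>Normals are computed on neighbourhoods contained in X; the null frontier of
  \<open>\<Omega>\<close> makes such neighbourhoods available almost everywhere.\<close>

lemma AE_interior: "AE x in sphere_measure. x \<in> X \<longrightarrow> x \<in> sphere_top interior_of \<Omega>"
  using AE_not_in[OF null_frontier] by eventually_elim (auto simp: X_def frontier_of_def)

context
  fixes w :: "nat \<Rightarrow> real"
  assumes w_pos: "\<And>j. j \<in> {1..N} \<Longrightarrow> 0 < w j"
begin

lemma rho_w_pos:
  assumes "x \<in> X" shows "0 < rho_w N P w x"
proof -
  obtain i where "i \<in> {1..N}" "rho_w N P w x = pr w i x" using rho_w_attained by blast
  then show ?thesis using polar_radius_pos[of "w i" "P i" x] w_pos P_nonzero norm_X[OF assms] by simp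
qed

lemma cell_supports:
  assumes "i \<in> {1..N}" "x \<in> cell w i"
  shows "supports_at X (rho_w N P w) (w i) (P i) x"
  using assms rho_w_le w_pos by (auto simp: supports_at_def mem_cell_iff)

lemma cell_subset_tau: "i \<in> {1..N} \<Longrightarrow> cell w i \<subseteq> tau X (rho_w N P w) {P i}"
  using cell_supports by (auto simp: tau_def cell_def)

lemma Union_cell: "(\<Union>i\<in>{1..N}. cell w i) = X"
proof
  show "X \<subseteq> (\<Union>i\<in>{1..N}. cell w i)"
  proof
    fix x assume "x \<in> X"
    obtain i where "i \<in> {1..N}" "rho_w N P w x = pr w i x" using rho_w_attained by blast
    then show "x \<in> (\<Union>i\<in>{1..N}. cell w i)" using \<open>x \<in> X\<close> by (auto simp: mem_cell_iff)
  qed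
qed (auto simp: cell_def)

lemma AE_tau_iff_cell:
  assumes i: "i \<in> {1..N}"
  shows "AE x in sphere_measure. x \<in> tau X (rho_w N P w) {P i} \<longleftrightarrow> x \<in> cell w i"
proof -
  let ?r = "rho_w N P w"
  \<comment> \<open>An ellipsoid with the same focus that is not below the surface at a contact
    point has at least the parameter of the supporting one. Applied in both directions, this makes
    the parameter of a supporting ellipsoid with focus \<open>P i\<close> unique.\<close>
  have le: "d \<le> d'" if "supports_at X ?r d (P i) x" "x \<in> X" "0 < d'" "?r x \<le> polar_radius d' (P i) x" for d d' x
    using that polar_radius_strict_mono[of d' d "P i" x] P_nonzero[OF i] norm_X
    by (fastforce simp: supports_at_def)
  show ?thesis
  proof (cases "\<exists>d x. d \<noteq> w i \<and> x \<in> X \<and> supports_at X ?r d (P i) x")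
    case False
    then have "x \<in> cell w i" if "x \<in> tau X ?r {P i}" for x
      using that i by (fastforce simp: tau_def supports_at_def mem_cell_iff)
    then show ?thesis using cell_subset_tau[OF i] by (intro AE_I2) blast
  next
    case True
    \<comment> \<open>If \<open>E\<^bsub>w i\<^esub>(P\<^sub>i)\<close> never touches the surface, another ellipsoid with focus \<open>P\<^sub>i\<close> may; it is unique, and it
      touches along intersections with the ellipsoids of the other foci.\<close>
    then obtain d z where d: "d \<noteq> w i" "z \<in> X" "supports_at X ?r d (P i) z" by blast
    then have "0 < d" by (simp add: supports_at_def)
    have "AE x in sphere_measure. \<forall>j\<in>{1..N} - {i}. polar_radius d (P i) x \<noteq> pr w j x"
      using AE_neq[OF i] \<open>0 < d\<close> w_pos by (intro AE_finite_allI) auto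
    then show ?thesis
    proof eventually_elim
      case (elim x)
      have "x \<in> cell w i" if "x \<in> tau X ?r {P i}"
      proof (rule ccontr)
        assume nc: "x \<notin> cell w i"
        obtain d' where x: "x \<in> X" and d': "supports_at X ?r d' (P i) x"
          using \<open>x \<in> tau X ?r {P i}\<close> by (auto simp: tau_def)
        have "0 < d'" "?r z \<le> polar_radius d' (P i) z" "?r x \<le> polar_radius d (P i) x"
          using d d' x by (auto simp: supports_at_def)
        then have "d = d'"
          using le[OF d(3,2), of d'] le[OF d' x, of d] \<open>0 < d\<close> by linarith
        then have "?r x = polar_radius d (P i) x" using d' by (simp add: supports_at_def)
        moreover obtain j where j: "j \<in> {1..N}" "?r x = pr w j x" using rho_w_attained by blast
        ultimately have "j = i" using elim by force
        then show False using nc j x i by (simp add: mem_cell_iff)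
      qed
      then show ?case using cell_subset_tau[OF i] by blast
    qed
  qed
qed

lemma sets_cell: "i \<in> {1..N} \<Longrightarrow> cell w i \<in> sets sphere_measure"
proof (rule sets_sphere_measure_borel)
  assume i: "i \<in> {1..N}"
  have "closed {x \<in> X. pr w i x \<le> pr w j x}" if "j \<in> {1..N}" for j
  proof -
    have "continuous_on X (pr w j)" if "j \<in> {1..N}" for j
      using continuous_on_polar_radius[of "w j" "P j"] w_pos P_nonzero that X_subset continuous_on_subset by blast
    then show ?thesis using that i closed_X by (intro continuous_on_closed_Collect_le) auto
  qed
  moreover have "cell w i = (\<Inter>j\<in>{1..N}. {x \<in> X. pr w i x \<le> pr w j x})"
    using i by (auto simp: cell_def)
  ultimately have "closed (cell w i)" by (auto intro: closed_INT)
  then show "cell w i \<in> sets borel" by simp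
qed (use X_subset in \<open>auto simp: cell_def\<close>)

lemma cell_factor_bounds:
  assumes "i \<in> {1..N}" "norm x = 1"
  shows "0 \<le> indicator (cell w i) x * ellipsoid_kernel (w i) (P i) x"
    "indicator (cell w i) x * ellipsoid_kernel (w i) (P i) x \<le> 4 / (w i)\<^sup>2"
  using ellipsoid_kernel_bounds[of "w i" "P i" x] assms w_pos P_nonzero
  by (auto simp: indicator_def)

lemma measurable_cell_factor:
  assumes "i \<in> {1..N}"
  shows "(\<lambda>x. indicator (cell w i) x * ellipsoid_kernel (w i) (P i) x) \<in> borel_measurable sphere_measure"
  using assms w_pos P_nonzero
  by (intro borel_measurable_times borel_measurable_indicator sets_cell
      borel_measurable_sphere_continuous continuous_on_ellipsoid_kernel) auto

lemma cell_integrable: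
  assumes i: "i \<in> {1..N}"
  shows "set_integrable sphere_measure (cell w i) (\<lambda>x. f x * ellipsoid_kernel (w i) (P i) x)"
  unfolding set_integrable_def cell_integrand_eq
proof (rule Bochner_Integration.integrable_bound)
  show "integrable sphere_measure (\<lambda>x. (4 / (w i)\<^sup>2) * (indicator X x *\<^sub>R f x))"
    using integrable_f unfolding set_integrable_def by (rule integrable_mult_right)
  show "(\<lambda>x. indicator X x *\<^sub>R f x * (indicator (cell w i) x * ellipsoid_kernel (w i) (P i) x))
      \<in> borel_measurable sphere_measure"
    using integrable_f unfolding set_integrable_def
    by (intro borel_measurable_times measurable_cell_factor i) auto
  show "AE x in sphere_measure. norm (indicator X x *\<^sub>R f x * (indicator (cell w i) x * ellipsoid_kernel (w i) (P i) x))
      \<le> norm ((4 / (w i)\<^sup>2) * (indicator X x *\<^sub>R f x))"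
  proof (rule AE_mp[OF AE_space], intro AE_I2 impI)
    fix x assume "x \<in> space sphere_measure"
    then have "norm x = 1" by (simp add: space_sphere_measure)
    from cell_factor_bounds[OF i this]
    have "norm (indicator (cell w i) x * ellipsoid_kernel (w i) (P i) x) \<le> 4 / (w i)\<^sup>2" by simp
    then show "norm (indicator X x *\<^sub>R f x * (indicator (cell w i) x * ellipsoid_kernel (w i) (P i) x))
      \<le> norm ((4 / (w i)\<^sup>2) * (indicator X x *\<^sub>R f x))"
      unfolding norm_mult by (subst mult.commute, intro mult_right_mono) auto
  qed
qed

text \<open>Strict inequalities between finitely many continuous radii persist on a neighbourhood,
  where \<open>rho_w\<close> is therefore the polar radius of a single ellipsoid.\<close>

lemma normal_in_cell:
  assumes i: "i \<in> {1..N}" and x: "x \<in> sphere_top interior_of \<Omega>"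
    and strict: "\<And>j. j \<in> {1..N} \<Longrightarrow> j \<noteq> i \<Longrightarrow> pr w i x < pr w j x"
  shows "outer_unit_normal (radial_graph X (rho_w N P w)) (rho_w N P w x *\<^sub>R x) = sgn (x - ecc (w i) (P i) *\<^sub>R sgn (P i))"
proof -
  define T where "T j = {y \<in> sphere 0 1. pr w i y - pr w j y \<in> {..<0}}" for j
  define U where "U = sphere_top interior_of \<Omega> \<inter> (\<Inter>j\<in>{1..N} - {i}. T j)"
  have ne: "x \<in> X" "x \<in> sphere 0 1"
    using x interior_of_subset_closure_of[of sphere_top \<Omega>] X_subset X_def by auto
  have T: "openin sphere_top (T j)" if "j \<in> {1..N}" for j
  proof -
    have "continuous_on (sphere 0 1) (\<lambda>y. pr w i y - pr w j y)"
      using that i w_pos P_nonzero by (intro continuous_intros continuous_on_polar_radius) auto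
    then show ?thesis
      using continuous_openin_preimage_gen[of "sphere 0 1" "\<lambda>y. pr w i y - pr w j y" "{..<0}"]
      by (simp add: T_def vimage_def Int_def)
  qed
  have "openin sphere_top U"
  \<comment> \<open>For N = 1 the intersection is over an empty family and equals
    \<open>UNIV\<close>, which is not open in \<open>sphere_top\<close>.\<close>
  proof (cases "{1..N} - {i} = {}")
    case True
    then show ?thesis unfolding U_def True by (simp add: openin_interior_of)
  next
    case False
    then show ?thesis unfolding U_def using T by (intro openin_Int openin_INT2 openin_interior_of) auto
  qed
  moreover have "U \<subseteq> X" using interior_of_subset_closure_of[of sphere_top \<Omega>] by (auto simp: U_def X_def)
  moreover have "x \<in> U" using x ne strict by (auto simp: U_def T_def)
  moreover have "rho_w N P w y = pr w i y" if "y \<in> U" for y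
  proof -
    have "pr w i y \<le> pr w j y" if "j \<in> {1..N}" for j
    proof (cases "j = i")
      case False
      then have "y \<in> T j" using that \<open>y \<in> U\<close> by (auto simp: U_def)
      then show ?thesis by (simp add: T_def)
    qed simp
    then have "y \<in> cell w i"
      using that \<open>U \<subseteq> X\<close> by (auto simp: cell_def)
    then show ?thesis using i by (simp add: mem_cell_iff)
  qed
  ultimately show ?thesis
    using i w_pos P_nonzero X_subset rho_w_pos by (intro outer_unit_normal_radial_graph) auto
qed

text \<open>The integrands agree off three null sets: the discrepancy between \<open>tau\<close> and
  the cell, the frontier of \<open>\<Omega>\<close>, and the ties between ellipsoids.\<close>

lemma refl_measure_eq_cell_mass:
  assumes i: "i \<in> {1..N}"
  shows "refl_measure X f (rho_w N P w) {P i} = cell_mass w i"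
  unfolding refl_measure_def cell_mass_def set_lebesgue_integral_def
proof (rule integral_sphere_measure_cong_AE[symmetric])
  let ?r = "rho_w N P w"
  show "(\<lambda>x. indicator (cell w i) x *\<^sub>R (f x * ellipsoid_kernel (w i) (P i) x)) \<in> borel_measurable sphere_measure"
    using cell_integrable[OF i] by (auto simp: set_integrable_def)
  have "AE x in sphere_measure. \<forall>j\<in>{1..N} - {i}. pr w i x \<noteq> pr w j x"
    using AE_neq[OF i] w_pos i by (intro AE_finite_allI) auto
  with AE_tau_iff_cell[OF i] AE_interior
  show "AE x in sphere_measure. indicator (cell w i) x *\<^sub>R (f x * ellipsoid_kernel (w i) (P i) x) =
      indicator (tau X ?r {P i}) x *\<^sub>R
        (f x * (x \<bullet> outer_unit_normal (radial_graph X ?r) (?r x *\<^sub>R x) / (?r x)\<^sup>2))"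
  proof eventually_elim
    case (elim x)
    show ?case
    proof (cases "x \<in> cell w i")
      case True
      then have "pr w i x < pr w j x" if "j \<in> {1..N}" "j \<noteq> i" for j
        using that elim by (auto simp: cell_def less_le)
      then show ?thesis
        using True elim normal_in_cell[OF i, of x] i by (simp add: ellipsoid_kernel_def mem_cell_iff)
    qed (use elim in simp)
  qed
qed

end

section \<open>Dependence of the cell masses on the weights\<close>

abbreviation (input) cell_factor :: "(nat \<Rightarrow> real) \<Rightarrow> nat \<Rightarrow> real^3 \<Rightarrow> real" where
  "cell_factor w i x \<equiv> indicator (cell w i) x * ellipsoid_kernel (w i) (P i) x"

lemma cell_mass_altdef:
  "cell_mass w i = (LINT x|sphere_measure. (indicator X x *\<^sub>R f x) * cell_factor w i x)"
  unfolding cell_mass_def set_lebesgue_integral_def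
  by (intro Bochner_Integration.integral_cong) (auto simp: cell_def indicator_def)

lemma integrable_cell_factor:
  assumes "\<And>j. j \<in> {1..N} \<Longrightarrow> 0 < w j" "i \<in> {1..N}"
  shows "integrable sphere_measure (\<lambda>x. (indicator X x *\<^sub>R f x) * cell_factor w i x)"
proof -
  have "set_integrable sphere_measure (cell w i) (\<lambda>x. f x * ellipsoid_kernel (w i) (P i) x)"
    using assms by (intro cell_integrable) blast+
  then show ?thesis unfolding set_integrable_def cell_integrand_eq .
qed

lemma AE_f_nonneg: "AE x in sphere_measure. 0 \<le> indicator X x *\<^sub>R f x"
  using f_pos by eventually_elim (auto simp: indicator_def)

text \<open>A weak inequality suffices: the cell then consists of ties with the ellipsoid of index
  j, a null set.\<close>

lemma cell_mass_eq_0: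
  assumes w: "\<And>j. j \<in> {1..N} \<Longrightarrow> 0 < w j" and ij: "i \<in> {1..N}" "j \<in> {1..N}" "i \<noteq> j"
    and le: "\<And>x. x \<in> X \<Longrightarrow> pr w j x \<le> pr w i x"
  shows "cell_mass w i = 0"
  unfolding cell_mass_altdef
proof (rule integral_eq_zero_AE)
  from AE_neq[OF ij w[OF ij(1)] w[OF ij(2)]]
  show "AE x in sphere_measure. (indicator X x *\<^sub>R f x) * cell_factor w i x = 0"
  proof eventually_elim
    case (elim x)
    have "x \<notin> cell w i"
    proof
      assume "x \<in> cell w i"
      then have "pr w i x \<le> pr w j x" "x \<in> X" using ij by (auto simp: cell_def)
      then show False using elim le[of x] by simp
    qed
    then show ?case by simp
  qed
qed

text \<open>With \<open>w i\<close> fixed the kernel does not change; lowering the other radii only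
  shrinks the cell.\<close>

lemma cell_mass_mono:
  assumes w: "\<And>j. j \<in> {1..N} \<Longrightarrow> 0 < w j" and w': "\<And>j. j \<in> {1..N} \<Longrightarrow> 0 < w' j \<and> w' j \<le> w j"
    and i: "i \<in> {1..N}" "w' i = w i"
  shows "cell_mass w' i \<le> cell_mass w i"
  unfolding cell_mass_altdef
proof (rule integral_mono_AE)
  show "integrable sphere_measure (\<lambda>x. (indicator X x *\<^sub>R f x) * cell_factor w' i x)"
    "integrable sphere_measure (\<lambda>x. (indicator X x *\<^sub>R f x) * cell_factor w i x)"
    using w w' i(1) by (intro integrable_cell_factor; blast)+
  have sub: "cell w' i \<subseteq> cell w i"
  proof
    fix x assume x: "x \<in> cell w' i"
    have "pr w i x \<le> pr w j x" if j: "j \<in> {1..N}" for j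
    proof -
      have "pr w i x \<le> pr w' j x" using x j i by (auto simp: cell_def)
      also have "\<dots> \<le> pr w j x"
        using polar_radius_strict_mono[of "w' j" "w j" "P j" x] w'[OF j] P_nonzero[OF j] norm_X[of x] x
        by (cases "w' j = w j") (auto simp: cell_def)
      finally show ?thesis .
    qed
    then show "x \<in> cell w i" using x by (simp add: cell_def)
  qed
  from AE_f_nonneg AE_space
  show "AE x in sphere_measure. (indicator X x *\<^sub>R f x) * cell_factor w' i x
      \<le> (indicator X x *\<^sub>R f x) * cell_factor w i x"
  proof eventually_elim
    case (elim x)
    then have "0 \<le> ellipsoid_kernel (w i) (P i) x"
      using ellipsoid_kernel_bounds(1)[of "w i" "P i" x] w i P_nonzero by (simp add: space_sphere_measure)
    then have "cell_factor w' i x \<le> cell_factor w i x"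
      using sub i by (auto simp: indicator_def)
    then show ?case using elim by (intro mult_left_mono) auto
  qed
qed

text \<open>Dominated convergence. Off the ties, membership and non-membership in the limit cell are
  both witnessed by strict inequalities, so the indicators are eventually constant. The common lower
  bound a on the weights supplies the majorant 4/a^2 |f|.\<close>

lemma tendsto_cell_mass:
  assumes W: "\<And>n j. j \<in> {1..N} \<Longrightarrow> a \<le> W n j" and a: "0 < a"
    and lim: "\<And>j. j \<in> {1..N} \<Longrightarrow> (\<lambda>n. W n j) \<longlonglongrightarrow> w j"
    and i: "i \<in> {1..N}"
  shows "(\<lambda>n. cell_mass (W n) i) \<longlonglongrightarrow> cell_mass w i"
  unfolding cell_mass_altdef
proof (rule integral_dominated_convergence[where w = "\<lambda>x. 4 / a\<^sup>2 * norm (indicator X x *\<^sub>R f x)"])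
  have w_ge: "a \<le> w j" if "j \<in> {1..N}" for j
    using LIMSEQ_le_const[OF lim[OF that]] W[OF that] by blast
  have pos: "0 < w j" "0 < W n j" if "j \<in> {1..N}" for n j
    using w_ge[OF that] W[OF that, of n] a by linarith+
  show "(\<lambda>x. (indicator X x *\<^sub>R f x) * cell_factor w i x) \<in> borel_measurable sphere_measure"
    using integrable_cell_factor[of w i] pos i by blast
  show "(\<lambda>x. (indicator X x *\<^sub>R f x) * cell_factor (W n) i x) \<in> borel_measurable sphere_measure" for n
    using integrable_cell_factor[of "W n" i] pos i by blast
  show "integrable sphere_measure (\<lambda>x. 4 / a\<^sup>2 * norm (indicator X x *\<^sub>R f x))"
    using integrable_f unfolding set_integrable_def by (intro integrable_mult_right integrable_norm)
  show "AE x in sphere_measure. norm ((indicator X x *\<^sub>R f x) * cell_factor (W n) i x)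
      \<le> 4 / a\<^sup>2 * norm (indicator X x *\<^sub>R f x)" for n
    using AE_space
  proof eventually_elim
    case (elim x)
    then have "norm x = 1" by (simp add: space_sphere_measure)
    then have b: "0 \<le> cell_factor (W n) i x" "cell_factor (W n) i x \<le> 4 / (W n i)\<^sup>2"
      using pos(2) i by (intro cell_factor_bounds; blast)+
    have "4 / (W n i)\<^sup>2 \<le> 4 / a\<^sup>2"
      using W[OF i, of n] a pos(2)[OF i, of n] by (intro divide_left_mono power_mono) auto
    then have "norm (cell_factor (W n) i x) \<le> 4 / a\<^sup>2" using b by simp
    then show ?case unfolding norm_mult
      by (subst mult.commute, intro mult_right_mono) auto
  qed
  have "AE x in sphere_measure. \<forall>j\<in>{1..N} - {i}. pr w i x \<noteq> pr w j x"
    using AE_neq[OF i] pos i by (intro AE_finite_allI) auto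
  then show "AE x in sphere_measure. (\<lambda>n. (indicator X x *\<^sub>R f x) * cell_factor (W n) i x)
      \<longlonglongrightarrow> (indicator X x *\<^sub>R f x) * cell_factor w i x"
  proof eventually_elim
    case (elim x)
    show ?case
    proof (cases "x \<in> X")
      case True
      have ev_less: "eventually (\<lambda>n. u n < v n) sequentially"
        if "u \<longlonglongrightarrow> l" "v \<longlonglongrightarrow> l'" "l < l'" for u v :: "nat \<Rightarrow> real" and l l'
        using order_tendstoD(1)[OF tendsto_diff[OF that(2,1)], of 0] that(3) by simp
      have pr_lim: "(\<lambda>n. pr (W n) j x) \<longlonglongrightarrow> pr w j x" if "j \<in> {1..N}" for j
        using that lim pos P_nonzero norm_X[OF True] by (intro tendsto_polar_radius) auto
      have "eventually (\<lambda>n. x \<in> cell (W n) i \<longleftrightarrow> x \<in> cell w i) sequentially"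
      proof (cases "x \<in> cell w i")
        case in_cell: True
        have "eventually (\<lambda>n. pr (W n) i x \<le> pr (W n) j x) sequentially" if j: "j \<in> {1..N}" for j
        proof (cases "j = i")
          case False
          then have "pr w i x < pr w j x" using in_cell elim j by (auto simp: cell_def less_le)
          from ev_less[OF pr_lim[OF i] pr_lim[OF j] this]
          show ?thesis by eventually_elim simp
        qed simp
        then have "eventually (\<lambda>n. \<forall>j\<in>{1..N}. pr (W n) i x \<le> pr (W n) j x) sequentially"
          by (intro eventually_ball_finite) auto
        then show ?thesis by eventually_elim (use in_cell in \<open>simp add: cell_def\<close>)
      next
        case out: False
        then obtain j where j: "j \<in> {1..N}" "pr w j x < pr w i x" using True by (auto simp: cell_def not_le)
        from ev_less[OF pr_lim[OF j(1)] pr_lim[OF i] j(2)]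
        show ?thesis
        proof eventually_elim
          case (elim n)
          then have "x \<notin> cell (W n) i" using j(1) unfolding cell_def by force
          then show ?case using out by simp
        qed
      qed
      then have "eventually (\<lambda>n. indicator (cell (W n) i) x = (indicator (cell w i) x :: real)) sequentially"
        by eventually_elim (simp add: indicator_def)
      then have "(\<lambda>n. indicator (cell (W n) i) x :: real) \<longlonglongrightarrow> indicator (cell w i) x"
        by (rule tendsto_eventually)
      then show ?thesis
        using lim[OF i] pos(1)[OF i] P_nonzero[OF i] norm_X[OF True]
        by (intro tendsto_mult tendsto_const tendsto_ellipsoid_kernel) auto
    qed simp
  qed
qed

text \<open>The cells cover X, so the sum H of the cell factors exceeds the constant at each point
  of X; overlaps only add nonnegative terms. Integrating against f gives the claim.\<close>

lemma sum_cell_mass_gt: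
  assumes w: "\<And>j. j \<in> {1..N} \<Longrightarrow> 0 < w j" and \<delta>: "0 < \<delta>"
    and w_ge: "\<And>j. j \<in> {1..N} \<Longrightarrow> \<delta> * norm (P j) \<le> w j"
    and R: "\<And>x. x \<in> X \<Longrightarrow> rho_w N P w x \<le> R"
    and f0: "0 < (LINT x : X | sphere_measure. f x)"
  shows "(1 - c_delta \<delta>) / (1 + c_delta \<delta>) / R\<^sup>2 * (LINT x : X | sphere_measure. f x)
    < (\<Sum>i\<in>{1..N}. cell_mass w i)"
proof -
  define K where "K = (1 - c_delta \<delta>) / (1 + c_delta \<delta>) / R\<^sup>2"
  define F where "F x = indicator X x *\<^sub>R f x" for x
  define H where "H x = (\<Sum>i\<in>{1..N}. cell_factor w i x)" for x
  have H_gt: "K < H x" if "x \<in> X" for x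
  proof -
    obtain i where i: "i \<in> {1..N}" "rho_w N P w x = pr w i x" using rho_w_attained by blast
    then have "x \<in> cell w i" using that by (simp add: mem_cell_iff)
    have "K < ellipsoid_kernel (w i) (P i) x"
      unfolding K_def using i w[OF i(1)] w_ge[OF i(1)] P_nonzero[OF i(1)] norm_X[OF that] \<delta> R[OF that]
      by (intro ellipsoid_kernel_gt) auto
    also have "\<dots> = cell_factor w i x" using \<open>x \<in> cell w i\<close> by simp
    also have "\<dots> \<le> H x"
      unfolding H_def using i cell_factor_bounds(1)[of w] w norm_X[OF that] by (intro member_le_sum) blast+
    finally show ?thesis .
  qed
  have F_int: "integrable sphere_measure F"
    using integrable_f unfolding set_integrable_def F_def .
  have FH: "F x * H x = (\<Sum>i\<in>{1..N}. F x * cell_factor w i x)" for x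
    unfolding H_def by (rule sum_distrib_left)
  have FH_int: "integrable sphere_measure (\<lambda>x. F x * H x)"
    unfolding FH unfolding F_def by (intro Bochner_Integration.integrable_sum integrable_cell_factor w)
  have "(\<Sum>i\<in>{1..N}. cell_mass w i) = (LINT x|sphere_measure. F x * H x)"
    unfolding FH unfolding cell_mass_altdef F_def
    by (intro Bochner_Integration.integral_sum[symmetric] integrable_cell_factor w)
  moreover have "K * (LINT x : X | sphere_measure. f x) = (LINT x|sphere_measure. K * F x)"
    by (simp add: set_lebesgue_integral_def F_def)
  moreover have "(LINT x|sphere_measure. K * F x) < (LINT x|sphere_measure. F x * H x)"
  \<comment> \<open>Strictness survives integration: otherwise the nonnegative F (H - K) has
    integral 0, so F vanishes almost everywhere, against the positive integral of f.\<close>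
  proof (rule ccontr)
    assume not_less: "\<not> ?thesis"
    have D_int: "integrable sphere_measure (\<lambda>x. F x * H x - K * F x)"
      by (intro Bochner_Integration.integrable_diff FH_int integrable_mult_right F_int)
    have nonneg: "AE x in sphere_measure. 0 \<le> F x * H x - K * F x"
      using AE_f_nonneg
    proof eventually_elim
      case (elim x)
      have "0 \<le> F x * (H x - K)"
        using elim H_gt[of x] by (cases "x \<in> X") (auto simp: F_def)
      then show ?case by (simp add: algebra_simps)
    qed
    have "(LINT x|sphere_measure. F x * H x - K * F x) \<le> 0"
      using not_less FH_int F_int by (subst Bochner_Integration.integral_diff) auto
    then have "(LINT x|sphere_measure. F x * H x - K * F x) = 0"
      using integral_nonneg_AE[OF nonneg] by linarith
    then have "AE x in sphere_measure. F x * H x - K * F x = 0"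
      using integral_nonneg_eq_0_iff_AE[OF D_int nonneg] by blast
    then have "AE x in sphere_measure. F x = 0"
    proof eventually_elim
      case (elim x)
      then have "F x * (H x - K) = 0" by (simp add: algebra_simps)
      then show ?case using H_gt[of x] by (cases "x \<in> X") (auto simp: F_def)
    qed
    then have "(LINT x|sphere_measure. F x) = 0" by (rule integral_eq_zero_AE)
    then show False using f0 by (simp add: set_lebesgue_integral_def F_def)
  qed
  ultimately show ?thesis unfolding K_def[symmetric] by (simp only:)
qed

section \<open>The minimisation over weight vectors\<close>

lemma exists_prescribed_cell_mass:
  assumes a: "0 < a" "a \<le> c" "a \<le> L"
    and g: "\<And>i. i \<in> {1..N} \<Longrightarrow> 0 < g i"
    and far: "\<And>i x. i \<in> {2..N} \<Longrightarrow> x \<in> X \<Longrightarrow> polar_radius c (P 1) x \<le> polar_radius L (P i) x"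
    and near: "\<And>i x. i \<in> {2..N} \<Longrightarrow> x \<in> X \<Longrightarrow> polar_radius a (P i) x \<le> polar_radius c (P 1) x"
    and total: "\<And>w. w 1 = c \<Longrightarrow> (\<And>i. i \<in> {1..N} \<Longrightarrow> a \<le> w i) \<Longrightarrow> (\<Sum>i\<in>{1..N}. g i) < (\<Sum>i\<in>{1..N}. cell_mass w i)"
  shows "\<exists>w. (\<forall>i\<in>{1..N}. a \<le> w i) \<and> (\<forall>i\<in>{2..N}. cell_mass w i = g i) \<and> g 1 < cell_mass w 1"
proof -
  \<comment> \<open>Weight vectors are functions on all of \<open>nat\<close>; pinning every
    coordinate outside 2..N to c makes the box a product of compact sets. The upper end L is there
    for compactness.\<close>
  define K where "K = (\<Pi>\<^sub>E j\<in>UNIV. if j \<in> {2..N} then {a..L} else {c})"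
  define A where "A = {w \<in> K. \<forall>i\<in>{2..N}. cell_mass w i \<le> g i}"
  have mem_K: "w \<in> K \<longleftrightarrow> (\<forall>j. if j \<in> {2..N} then a \<le> w j \<and> w j \<le> L else w j = c)" for w
    unfolding K_def by (auto simp: PiE_iff)
  have K_ge: "a \<le> w j" if "w \<in> K" for w j
    using that a by (cases "j \<in> {2..N}") (force simp: mem_K)+
  have K_1: "w 1 = c" if "w \<in> K" for w
    using that by (force simp: mem_K)
  have split: "{1..N} = insert 1 {2..N}" using N_pos by auto
  have "compact K"
  proof -
    have "compactin (product_topology (\<lambda>i. euclidean) UNIV) K"
      unfolding K_def compactin_PiE by auto
    then show ?thesis by (simp add: euclidean_product_topology)
  qed
  moreover have "closed A"
    unfolding closed_sequential_limits
  proof (intro allI impI, elim conjE)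
    fix W :: "nat \<Rightarrow> nat \<Rightarrow> real" and w assume WA: "\<forall>n. W n \<in> A" and W: "W \<longlonglongrightarrow> w"
    have coord: "(\<lambda>n. W n j) \<longlonglongrightarrow> w j" for j
      using continuous_on_tendsto_compose[OF continuous_on_product_coordinates[of j] W] by simp
    have "w \<in> K"
      using closed_sequentially[OF compact_imp_closed[OF \<open>compact K\<close>] _ W] WA by (auto simp: A_def)
    moreover have "cell_mass w i \<le> g i" if i: "i \<in> {2..N}" for i
    proof (rule LIMSEQ_le_const2)
      show "(\<lambda>n. cell_mass (W n) i) \<longlonglongrightarrow> cell_mass w i"
        using WA K_ge a i coord by (intro tendsto_cell_mass[where a = a]) (auto simp: A_def)
      show "\<exists>n0. \<forall>n\<ge>n0. cell_mass (W n) i \<le> g i" using WA i by (auto simp: A_def)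
    qed
    ultimately show "w \<in> A" by (simp add: A_def)
  qed
  ultimately have "compact A"
    using compact_Int_closed[of K A] by (simp add: A_def Int_def)
  \<comment> \<open>With all other weights at L, every focus but the first has mass 0, so the
    feasible set is nonempty.\<close>
  moreover have "(\<lambda>j. if j \<in> {2..N} then L else c) \<in> A"
  proof -
    let ?w = "\<lambda>j. if j \<in> {2..N} then L else c"
    have "cell_mass ?w i = 0" if i: "i \<in> {2..N}" for i
    proof (rule cell_mass_eq_0)
      show "1 \<in> {1..N}" using N_pos by auto
    qed (use i far[OF i] a in auto)
    then show ?thesis using a g by (auto simp: A_def mem_K intro: less_imp_le)
  qed
  moreover have "continuous_on A (\<lambda>w. \<Sum>j\<in>{2..N}. w j)"
    by (intro continuous_intros continuous_on_subset[OF continuous_on_product_coordinates]) auto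
  ultimately obtain w where w: "w \<in> A" and min: "\<And>w'. w' \<in> A \<Longrightarrow> (\<Sum>j\<in>{2..N}. w j) \<le> (\<Sum>j\<in>{2..N}. w' j)"
    using continuous_attains_inf[of A "\<lambda>w. \<Sum>j\<in>{2..N}. w j"] by blast
  have wK: "w \<in> K" and w_mass: "\<And>i. i \<in> {2..N} \<Longrightarrow> cell_mass w i \<le> g i"
    using w by (auto simp: A_def)
  have w_pos: "0 < w j" for j using K_ge[OF wK, of j] a by linarith
  have "(\<Sum>i\<in>{2..N}. cell_mass w i) \<le> (\<Sum>i\<in>{2..N}. g i)"
    using w_mass by (rule sum_mono)
  then have mass_1: "g 1 < cell_mass w 1"
    using total[of w] K_1[OF wK] K_ge[OF wK] unfolding split by simp
  have "cell_mass w i = g i" if i: "i \<in> {2..N}" for i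
  proof (rule ccontr)
    assume "cell_mass w i \<noteq> g i"
    then have less: "cell_mass w i < g i" using w_mass[OF i] by simp
    have i1: "i \<in> {1..N}" "i \<noteq> 1" using i by auto
    have "w i \<noteq> a"
    proof
      assume "w i = a"
      then have "cell_mass w 1 = 0"
        using near[OF i] K_1[OF wK] i1 w_pos N_pos by (intro cell_mass_eq_0[of w 1 i]) auto
      then show False using mass_1 g[of 1] N_pos by simp
    qed
    then have wi: "a < w i" using K_ge[OF wK, of i] by simp
    \<comment> \<open>The i-th weight climbs from a at n = 0 back to \<open>w i\<close>, always
      staying below it. By continuity some n still has mass below \<open>g i\<close>, and that
      vector is feasible with a smaller sum.\<close>
    define W where "W n = w(i := w i - (w i - a) / real (Suc n))" for n
    have step: "0 < (w i - a) / real (Suc n)" "(w i - a) / real (Suc n) \<le> w i - a" for n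
      using wi divide_left_mono[of 1 "real (Suc n)" "w i - a"] by auto
    have W_i: "W n i < w i" "a \<le> W n i" for n
      using step[of n] by (auto simp: W_def)
    have W_ge: "a \<le> W n j" for n j
      using W_i[of n] K_ge[OF wK, of j] by (cases "j = i") (auto simp: W_def)
    have W_le: "W n j \<le> w j" for n j
      using W_i[of n] by (cases "j = i") (auto simp: W_def)
    have "(\<lambda>n. cell_mass (W n) i) \<longlonglongrightarrow> cell_mass w i"
    proof (rule tendsto_cell_mass[OF _ a(1) _ i1(1)])
      have "(\<lambda>n. w i - (w i - a) * inverse (real (Suc n))) \<longlonglongrightarrow> w i - (w i - a) * 0"
        by (intro tendsto_intros LIMSEQ_inverse_real_of_nat)
      then show "(\<lambda>n. W n j) \<longlonglongrightarrow> w j" for j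
        by (cases "j = i") (auto simp: W_def divide_inverse)
    qed (rule W_ge)
    then have "eventually (\<lambda>n. cell_mass (W n) i < g i) sequentially"
      using less by (rule order_tendstoD)
    then obtain n where n: "cell_mass (W n) i < g i" by (auto simp: eventually_sequentially)
    have "cell_mass (W n) j \<le> g j" if j: "j \<in> {2..N}" for j
    proof (cases "j = i")
      case False
      have "0 < W n l" for l using W_ge[of n l] a by linarith
      then have "cell_mass (W n) j \<le> cell_mass w j"
        using False j w_pos W_le by (intro cell_mass_mono) (auto simp: W_def)
      then show ?thesis using w_mass[OF j] by simp
    qed (use n in simp)
    moreover have "W n \<in> K"
    proof -
      have "w i \<le> L" using wK i by (force simp: mem_K)
      then have "if j \<in> {2..N} then a \<le> W n j \<and> W n j \<le> L else W n j = c" for j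
        using wK[unfolded mem_K, rule_format, of j] W_i[of n] i
        by (cases "j = i") (auto simp: W_def)
      then show ?thesis by (simp add: mem_K)
    qed
    ultimately have "(\<Sum>j\<in>{2..N}. w j) \<le> (\<Sum>j\<in>{2..N}. W n j)" by (intro min) (simp add: A_def)
    moreover have "(\<Sum>j\<in>{2..N}. W n j) < (\<Sum>j\<in>{2..N}. w j)"
      using W_le W_i(1)[of n] i by (intro sum_strict_mono_ex1) auto
    ultimately show False by simp
  qed
  then show ?thesis using mass_1 K_ge[OF wK] by blast
qed

end

theorem theorem4p5:
  fixes \<Omega> X D :: "(real^3) set" and f :: "real^3 \<Rightarrow> real"
    and N :: nat and g :: "nat \<Rightarrow> real" and P :: "nat \<Rightarrow> real^3"
    and M \<delta> k :: real
  assumes "\<Omega> \<subseteq> sphere 0 1"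
    and "sphere_top frontier_of \<Omega> \<in> null_sets sphere_measure"
    and "X = sphere_top closure_of \<Omega>"
    and "set_integrable sphere_measure X f"
    and "AE x in sphere_measure. x \<in> X \<longrightarrow> f x > 0"
    and "N > 1"
    and "\<And>i. i \<in> {1..N} \<Longrightarrow> g i > 0"
    and "inj_on P {1..N}"
    and "D = P ` {1..N}"
    and "0 \<notin> D"
    and "M = Max ((\<lambda>i. norm (P i)) ` {1..N})"
    and "\<delta> > 0"
    and "k \<ge> (1 + c_delta \<delta>) / (1 - c_delta \<delta>)"
    and "(LINT x:X|sphere_measure. f x) \<ge> 1 / C_const \<delta> (k * \<delta>) M * eta N g P D"
  shows "\<exists>w. (\<forall>i\<in>{1..N}. w i \<ge> \<delta> * M)
    \<and> rho_w N P w \<in> refl_class X D M \<delta>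
    \<and> X = (\<Union>i\<in>{1..N}. tau X (rho_w N P w) {P i})
    \<and> (\<forall>i\<in>{2..N}. refl_measure X f (rho_w N P w) {P i} = g i)
    \<and> refl_measure X f (rho_w N P w) {P 1} > g 1"
proof -
  define c where "c = c_delta \<delta>"
  define a b where "a = \<delta> * M" and "b = k * a"
  have c: "0 < c" "c < 1" using c_delta_pos c_delta_less_1 \<open>\<delta> > 0\<close> by (auto simp: c_def)
  have N1: "1 \<in> {1..N}" using \<open>N > 1\<close> by simp
  have P0: "P i \<noteq> 0" if "i \<in> {1..N}" for i
    using that \<open>0 \<notin> D\<close> \<open>D = P ` {1..N}\<close> by force
  interpret reflector_data \<Omega> X f N P
    using assms P0 by unfold_locales auto
  have norm_P: "norm (P i) \<le> M" if "i \<in> {1..N}" for i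
    unfolding \<open>M = _\<close> using that by (intro Max_ge) auto
  have "0 < norm (P 1)" using P0[OF N1] by simp
  then have M: "0 < M" using norm_P[OF N1] by linarith
  have a: "0 < a" using M \<open>\<delta> > 0\<close> by (simp add: a_def)
  have k: "(1 + c) / (1 - c) \<le> k" using assms(13) by (simp add: c_def)
  moreover have "1 \<le> (1 + c) / (1 - c)" using c by simp
  ultimately have "1 \<le> k" by linarith
  then have ab: "a \<le> b" using a by (simp add: b_def)
  \<comment> \<open>Chosen so that the lower radius bound L/(1+c) for the other foci equals the
    upper bound b/(1-c) for the first.\<close>
  define L where "L = b * (1 + c) / (1 - c)"
  have bL: "b \<le> L"
    using a ab c mult_left_mono[OF \<open>1 \<le> (1 + c) / (1 - c)\<close>, of b] by (simp add: L_def)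
  have pr: "d / (1 + c) \<le> polar_radius d (P i) x" "polar_radius d (P i) x \<le> d / (1 - c)"
    if "i \<in> {1..N}" "a \<le> d" "x \<in> X" for d i x
  proof -
    have "\<delta> * norm (P i) \<le> a" unfolding a_def using norm_P[OF that(1)] \<open>\<delta> > 0\<close> by simp
    then show "d / (1 + c) \<le> polar_radius d (P i) x" "polar_radius d (P i) x \<le> d / (1 - c)"
      using that a P0 norm_X \<open>\<delta> > 0\<close> unfolding c_def by (auto intro!: polar_radius_bounds)
  qed
  have eta: "eta N g P D = (\<Sum>i\<in>{1..N}. g i)"
    by (simp add: eta_def \<open>D = P ` {1..N}\<close>)
  \<comment> \<open>Identifies the constant of the hypothesis with the kernel bound at maximal
    radius b/(1-c).\<close>
  have C: "C_const \<delta> (k * \<delta>) M = (1 - c) / (1 + c) / (b / (1 - c))\<^sup>2"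
    using c by (simp add: C_const_def c_def b_def a_def power_divide power2_eq_square power3_eq_cube mult.assoc)
  have C_pos: "0 < C_const \<delta> (k * \<delta>) M" unfolding C using c a ab by simp
  have g_pos: "0 < (\<Sum>i\<in>{1..N}. g i)" using assms(7) N1 by (intro sum_pos) auto
  have f_ge: "(\<Sum>i\<in>{1..N}. g i) \<le> C_const \<delta> (k * \<delta>) M * (LINT x:X|sphere_measure. f x)"
    using assms(14) C_pos unfolding eta by (simp add: field_simps)
  have f_int_pos: "0 < (LINT x:X|sphere_measure. f x)"
    using f_ge g_pos C_pos by (smt (verit) mult_nonneg_nonpos)
  have "\<exists>w. (\<forall>i\<in>{1..N}. a \<le> w i) \<and> (\<forall>i\<in>{2..N}. cell_mass w i = g i) \<and> g 1 < cell_mass w 1"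
  proof (rule exists_prescribed_cell_mass[OF a ab])
    show "a \<le> L" using ab bL by simp
    show "0 < g i" if "i \<in> {1..N}" for i using assms(7) that .
    show "polar_radius b (P 1) x \<le> polar_radius L (P i) x" if "i \<in> {2..N}" "x \<in> X" for i x
    proof -
      have "polar_radius b (P 1) x \<le> b / (1 - c)" using pr(2) N1 ab that by blast
      also have "\<dots> = L / (1 + c)" using c by (simp add: L_def)
      also have "\<dots> \<le> polar_radius L (P i) x" using pr(1)[of i L x] that ab bL by simp
      finally show ?thesis .
    qed
    show "polar_radius a (P i) x \<le> polar_radius b (P 1) x" if "i \<in> {2..N}" "x \<in> X" for i x
    proof -
      have "polar_radius a (P i) x \<le> a / (1 - c)" using pr(2)[of i a x] that by simp
      \<comment> \<open>After b = k a is inserted, this is exactly the lower bound imposed on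
        k.\<close>
      also have "\<dots> \<le> b / (1 + c)" using mult_left_mono[OF k, of a] a c by (simp add: b_def field_simps)
      also have "\<dots> \<le> polar_radius b (P 1) x" using pr(1) N1 ab that by blast
      finally show ?thesis .
    qed
    show "(\<Sum>i\<in>{1..N}. g i) < (\<Sum>i\<in>{1..N}. cell_mass w i)"
      if w: "w 1 = b" "\<And>i. i \<in> {1..N} \<Longrightarrow> a \<le> w i" for w
    proof -
      have "rho_w N P w x \<le> b / (1 - c)" if "x \<in> X" for x
        using rho_w_le[OF N1, of w x] pr(2)[OF N1 ab that] w by simp
      moreover have "0 < w j" "\<delta> * norm (P j) \<le> w j" if "j \<in> {1..N}" for j
      proof -
        show "0 < w j" using w(2)[OF that] a by linarith
        have "\<delta> * norm (P j) \<le> a" unfolding a_def using norm_P[OF that] \<open>\<delta> > 0\<close> by simp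
        then show "\<delta> * norm (P j) \<le> w j" using w(2)[OF that] by linarith
      qed
      ultimately have "C_const \<delta> (k * \<delta>) M * (LINT x:X|sphere_measure. f x) < (\<Sum>i\<in>{1..N}. cell_mass w i)"
        unfolding C c_def using \<open>\<delta> > 0\<close> f_int_pos by (intro sum_cell_mass_gt) auto
      then show ?thesis using f_ge by linarith
    qed
  qed
  then obtain w where w: "\<And>i. i \<in> {1..N} \<Longrightarrow> a \<le> w i"
    "\<And>i. i \<in> {2..N} \<Longrightarrow> cell_mass w i = g i" "g 1 < cell_mass w 1" by blast
  have w_pos: "0 < w i" if "i \<in> {1..N}" for i using w(1)[OF that] a by linarith
  have supports: "\<exists>i\<in>{1..N}. supports_at X (rho_w N P w) (w i) (P i) x" if "x \<in> X" for x
    using Union_cell[of w] cell_supports[of w] w_pos that by blast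
  have "rho_w N P w \<in> refl_class X D M \<delta>"
    using supports rho_w_pos[of w] w_pos w(1) unfolding refl_class_def reflector_def a_def \<open>D = _\<close>
    by fast
  moreover have "X = (\<Union>i\<in>{1..N}. tau X (rho_w N P w) {P i})"
    using supports by (fastforce simp: tau_def)
  moreover have "refl_measure X f (rho_w N P w) {P i} = cell_mass w i" if "i \<in> {1..N}" for i
    using refl_measure_eq_cell_mass[of w i] w_pos that by blast
  ultimately show ?thesis
    using w N1 unfolding a_def by (intro exI[of _ w]) auto
qed

end
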